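(* Let $G$ be an undirected connected graph with $n$ nodes, $m$ edges, positive edge weights, incidence matrix $B\in\mathbb{R}^{n\times m}$, diagonal weight matrix $\mathcal{A}\in\mathbb{R}^{m\times m}$, Laplacian $L=B\mathcal{A}B^\top$, weighted cutset projection $\mathcal{P}_{\mathrm{cut}}$ and weighted cycle projection $\mathcal{P}_{\mathrm{cyc}}$. Let $\omega\in\mathbf{1}_n^\perp$ satisfy $$\|B^\top L^\dagger\omega\|_\infty<h(\|\mathcal{P}_{\mathrm{cyc}}\|_\infty),$$ and define $\gamma^*\in[0,\frac{\pi}{2})$ by $$\gamma^*=\arccos\left(\frac{h^{-1}(\|B^\top L^\dagger\omega\|_\infty)}{h^{-1}(\|B^\top L^\dagger\omega\|_\infty)+1}\right).$$ Then, for the Kuramoto model $\dot\theta=\omega-B\mathcal{A}\sin(B^\top\theta)$, the following statements hold: (i) there exists a unique locally stable synchronization manifold $\mathbf{x}^*$ in $S^G(\gamma^* )$; and (ii) the power series $$\sum_{i=0}^\infty A_{2i+1}(B^\top L^\dagger\omega)=A_1(B^\top L^\dagger\omega)+A_3(B^\top L^\dagger\omega)+\cdots$$ converges strongly to $\sin(B^\top\mathbf{x}^* )$, where, for every integer $i\ge0$, the term $A_{2i+1}(\eta)$ is a homogeneous polynomial of order $2i+1$ in $\eta\in\mathbb{R}^m$, defined iteratively by $A_1(\eta)=\eta$ and, for $i\ge1$, $$A_{2i+1}(\eta)=-\mathcal{P}_{\mathrm{cyc}}\left(\sum_{k=1}^i\frac{(2k-1)!!}{(2k)!!\,(2k+1)}\sum_{\substack{\text{odd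 }\alpha_1,\dots,\alpha_{2k+1}\text{ s.t.}\\ \alpha_1+\cdots+\alpha_{2k+1}=2i+1}}A_{\alpha_1}(\eta)\circ\cdots\circ A_{\alpha_{2k+1}}(\eta)\right).$$
   Context: Graph notation: $G$ has node set $\{1,\dots,n\}$, edge set $\mathcal{E}$ with $m$ elements, no self-loops, and symmetric weights $a_{ij}=a_{ji}>0$ for $(i,j)\in\mathcal{E}$. $B$ is the (oriented) incidence matrix for an arbitrary fixed orientation, $\mathcal{A}=\mathrm{diag}(a_{ij})_{(i,j)\in\mathcal{E}}$, and $L^\dagger$ is the Moore–Penrose pseudoinverse of $L$. $\mathbf{1}_n$ is the all-ones vector and $\mathbf{1}_n^\perp=\{x\in\mathbb{R}^n : \mathbf{1}_n^\top x=0\}$. $\mathcal{P}_{\mathrm{cut}}=B^\top L^\dagger B\mathcal{A}$ (the oblique projection onto $\mathrm{Img}(B^\top)$ parallel to $\mathrm{Ker}(B\mathcal{A})$) and $\mathcal{P}_{\mathrm{cyc}}=I_m-B^\top L^\dagger B\mathcal{A}$. For matrices, $\|\cdot\|_\infty$ is the norm induced by the vector norm $\|\cdot\|_\infty$. $\sin$ acts componentwise. The symbol $\circ$ between vectors is the entrywise (Hadamard) product. Double factorial: $N!!=\prod_{k=0}^{\lceil N/2\rceil-1}(N-2k)$. The inner sum in the recursion is over ordered tuples of odd positive integers $(\alpha_1,\dots,\alpha_{2k+1})$. The function $h:\mathbb{R}_{\ge0}\to\mathbb{R}$ is $$h(x)=(x+1)\sqrt{1-\left(\tfrac{x}{x+1}\right)^2}-x\arccos\left(\tfrac{x}{x+1}\right);$$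 it is continuous and strictly decreasing with range $(0,1]$, and $h^{-1}:(0,1]\to\mathbb{R}_{\ge0}$ denotes its inverse. When $B^\top L^\dagger\omega=\mathbf{0}_m$, the formula for $\gamma^*$ is read as its limiting value $\gamma^*=0$. Kuramoto model: the dynamics $\dot\theta=\omega-B\mathcal{A}\sin(B^\top\theta)$ on $\mathbb{T}^n$ are considered on the quotient space $[\mathbb{T}^n]$ of the $n$-torus by simultaneous rotation of all phases, $\theta\sim(\theta_1+s,\dots,\theta_n+s)^\top$, $s\in[0,2\pi)$; $[\theta]$ denotes the class of $\theta$, and stability is understood for the induced dynamics on $[\mathbb{T}^n]$. If $\omega=B\mathcal{A}\sin(B^\top\theta^* )$, then $[\theta^*]$ is called a synchronization manifold. Embedded cohesive subset: for $\gamma\in[0,\frac{\pi}{2})$, $B^G(\gamma)=\{\mathbf{x}\in\mathbf{1}_n^\perp : \|B^\top\mathbf{x}\|_\infty\le\gamma\}$ and $S^G(\gamma)=\{[\exp(\mathrm{i}\mathbf{x})] : \mathbf{x}\in B^G(\gamma)\}\subseteq[\mathbb{T}^n]$, where $\exp(\mathrm{i}\mathbf{x})\in\mathbb{T}^n$ is the point with phase angles $\mathbf{x}$. $S^G(\gamma)$ is diffeomorphic to $B^G(\gamma)$ via $\mathbf{x}\mapsto[\exp(\mathrm{i}\mathbf{x})]$ and the two are identified: "the synchronization manifold $\mathbf{x}^*$ in $S^G(\gamma)$" means $[\exp(\mathrm{i}\mathbf{x}^* )]$ with $\mathbf{x}^*\in B^G(\gamma)$. Strong convergence: a power series $\sum_{\nu\in(\mathbb{Z}_{\ge0})^m}a_\nu(x-x_0)^\nu$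 (multi-index notation) converges strongly at $x$ if all rearrangements of its terms converge at $x$; the series in (ii) is the power series $\sum_i A_{2i+1}(\eta)$ in the components of $\eta$ around $\mathbf{0}_m$, evaluated at $\eta=B^\top L^\dagger\omega$. *)

theory Defs
  imports "HOL-Analysis.Analysis"
begin

text \<open>
  An undirected graph on the node type \<open>'n\<close> is its adjacency relation \<open>E\<close>; \<open>a $ i $ j\<close> is the
  weight of the edge between \<open>i\<close> and \<open>j\<close>.
\<close>

definition weighted_graph :: "('n \<times> 'n) set \<Rightarrow> real^'n^'n::finite \<Rightarrow> bool" where
  "weighted_graph E a \<longleftrightarrow> sym E \<and> irrefl E \<and> (\<forall>(i, j)\<in>E. a $ i $ j > 0 \<and> a $ i $ j = a $ j $ i)"

definition graph_connected :: "('n \<times> 'n) set \<Rightarrow> bool" where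
  "graph_connected E \<longleftrightarrow> (\<forall>i j. (i, j) \<in> E\<^sup>*)"

text \<open>
  The \<open>m\<close> undirected edges are numbered by the type \<open>'m\<close>, each with an arbitrarily chosen
  orientation: \<open>d e\<close> is the pair (tail, head) of the edge \<open>e\<close>.
\<close>

definition edge_orientation :: "('n \<times> 'n) set \<Rightarrow> ('m \<Rightarrow> 'n \<times> 'n) \<Rightarrow> bool" where
  "edge_orientation E d \<longleftrightarrow>
     range d \<subseteq> E \<and> (\<forall>(i, j)\<in>E. \<exists>!e. d e = (i, j) \<or> d e = (j, i))"

definition incidence_matrix :: "('m \<Rightarrow> 'n \<times> 'n) \<Rightarrow> real^'m::finite^'n::finite" where
  "incidence_matrix d =
     (\<chi> i e. if i = fst (d e) then 1 else if i = snd (d e) then - 1 else 0)"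

definition weight_matrix :: "('m \<Rightarrow> 'n \<times> 'n) \<Rightarrow> real^'n^'n::finite \<Rightarrow> real^'m^'m::finite" where
  "weight_matrix d a = (\<chi> e f. if e = f then a $ fst (d e) $ snd (d e) else 0)"

definition is_pseudoinverse :: "real^'k^'l::finite \<Rightarrow> real^'l^'k::finite \<Rightarrow> bool" where
  "is_pseudoinverse M X \<longleftrightarrow>
     M ** X ** M = M \<and> X ** M ** X = X \<and>
     transpose (M ** X) = M ** X \<and> transpose (X ** M) = X ** M"

definition pseudoinverse :: "real^'k^'l::finite \<Rightarrow> real^'l^'k::finite" where
  "pseudoinverse M = (THE X. is_pseudoinverse M X)"

definition laplacian :: "real^'m^'n::finite \<Rightarrow> real^'m^'m::finite \<Rightarrow> real^'n^'n" where
  "laplacian B W = B ** W ** transpose B"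

definition cutset_projection :: "real^'m^'n::finite \<Rightarrow> real^'m^'m::finite \<Rightarrow> real^'m^'m" where
  "cutset_projection B W = transpose B ** pseudoinverse (laplacian B W) ** B ** W"

definition cycle_projection :: "real^'m^'n::finite \<Rightarrow> real^'m^'m::finite \<Rightarrow> real^'m^'m" where
  "cycle_projection B W = mat 1 - cutset_projection B W"

text \<open>The operator norm induced by \<^const>\<open>infnorm\<close>, defined in the same way as \<^const>\<open>onorm\<close>.\<close>

definition matrix_infnorm :: "real^'k^'l::finite \<Rightarrow> real" where
  "matrix_infnorm M = (SUP x. infnorm (M *v x) / infnorm x)"

definition sin_vec :: "real^'k \<Rightarrow> real^'k::finite" where
  "sin_vec v = (\<chi> e. sin (v $ e))"

definition h_fun :: "real \<Rightarrow> real" where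
  "h_fun x = (x + 1) * sqrt (1 - (x / (x + 1))\<^sup>2) - x * arccos (x / (x + 1))"

definition h_inv :: "real \<Rightarrow> real" where
  "h_inv = the_inv_into {0..} h_fun"

text \<open>\<open>h_inv\<close> is meaningful on \<open>(0, 1]\<close> only; at \<open>0\<close> the angle is the limiting value \<open>0\<close>.\<close>

definition gamma_star :: "real \<Rightarrow> real" where
  "gamma_star y = (if y = 0 then 0 else arccos (h_inv y / (h_inv y + 1)))"

definition torus :: "(complex^'n::finite) set" where
  "torus = {z. \<forall>i. norm (z $ i) = 1}"

definition rotation_class :: "complex^'n::finite \<Rightarrow> (complex^'n) set" where
  "rotation_class z = {w. \<exists>s. 0 \<le> s \<and> s < 2 * pi \<and> w = (\<chi> i. cis s * z $ i)}"

definition quotient_torus :: "(complex^'n::finite) set set" where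
  "quotient_torus = rotation_class ` torus"

definition quotient_torus_topology :: "(complex^'n::finite) set topology" where
  "quotient_torus_topology = topology (\<lambda>U. U \<subseteq> quotient_torus \<and>
     openin (top_of_set torus) {z \<in> torus. rotation_class z \<in> U})"

lemma openin_quotient_torus_topology:
  fixes U :: "(complex^'n::finite) set set"
  shows "openin quotient_torus_topology U \<longleftrightarrow> U \<subseteq> quotient_torus \<and>
     openin (top_of_set torus) {z \<in> torus. rotation_class z \<in> U}"
proof -
  have "istopology (\<lambda>U :: (complex^'n) set set. U \<subseteq> quotient_torus \<and>
     openin (top_of_set torus) {z \<in> torus. rotation_class z \<in> U})"
    unfolding istopology_def
  proof (intro conjI allI impI; (elim conjE)?)
    fix S T :: "(complex^'n) set set"
    assume "S \<subseteq> quotient_torus"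
    then show "S \<inter> T \<subseteq> quotient_torus" by blast
  next
    fix S T :: "(complex^'n) set set"
    assume "openin (top_of_set torus) {z \<in> torus. rotation_class z \<in> S}"
      "openin (top_of_set torus) {z \<in> torus. rotation_class z \<in> T}"
    then have "openin (top_of_set torus)
        ({z \<in> torus. rotation_class z \<in> S} \<inter> {z \<in> torus. rotation_class z \<in> T})"
      by (rule openin_Int)
    also have "{z \<in> torus. rotation_class z \<in> S} \<inter> {z \<in> torus. rotation_class z \<in> T}
        = {z \<in> torus. rotation_class z \<in> S \<inter> T}" by blast
    finally show "openin (top_of_set torus) {z \<in> torus. rotation_class z \<in> S \<inter> T}" .
  next
    fix K :: "(complex^'n) set set set"
    assume K: "\<forall>S\<in>K. S \<subseteq> quotient_torus \<and>
      openin (top_of_set torus) {z \<in> torus. rotation_class z \<in> S}"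
    then show "\<Union>K \<subseteq> quotient_torus" by blast
    have "openin (top_of_set torus) (\<Union>S\<in>K. {z \<in> torus. rotation_class z \<in> S})"
      using K by (intro openin_Union) blast
    also have "(\<Union>S\<in>K. {z \<in> torus. rotation_class z \<in> S})
        = {z \<in> torus. rotation_class z \<in> \<Union>K}" by blast
    finally show "openin (top_of_set torus) {z \<in> torus. rotation_class z \<in> \<Union>K}" .
  qed
  then show ?thesis
    unfolding quotient_torus_topology_def by (simp only: topology_inverse')
qed

lemma topspace_quotient_torus_topology:
  "topspace quotient_torus_topology = (quotient_torus :: (complex^'n::finite) set set)"
proof
  show "topspace quotient_torus_topology \<subseteq> (quotient_torus :: (complex^'n) set set)"
    unfolding topspace_def openin_quotient_torus_topology by blast
  have "{z \<in> torus. rotation_class z \<in> (quotient_torus :: (complex^'n) set set)} = torus"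
    unfolding quotient_torus_def by blast
  then have "openin quotient_torus_topology (quotient_torus :: (complex^'n) set set)"
    unfolding openin_quotient_torus_topology by simp
  then show "(quotient_torus :: (complex^'n) set set) \<subseteq> topspace quotient_torus_topology"
    by (rule openin_subset)
qed

lemma quotient_map_rotation_class:
  "quotient_map (top_of_set torus) quotient_torus_topology
     (rotation_class :: complex^'n::finite \<Rightarrow> _)"
  unfolding quotient_map_def topspace_quotient_torus_topology openin_quotient_torus_topology
  by (auto simp: quotient_torus_def)

text \<open>The class \<open>[exp(\<i> \<theta>)]\<close> of the point of the torus with phase angles \<open>\<theta>\<close>.\<close>

definition phase_class :: "real^'n::finite \<Rightarrow> (complex^'n) set" where
  "phase_class \<theta> = rotation_class (\<chi> i. cis (\<theta> $ i))"

definition cohesive_vectors :: "real^'m::finite^'n::finite \<Rightarrow> real \<Rightarrow> (real^'n) set" where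
  "cohesive_vectors B \<gamma> = {x. 1 \<bullet> x = 0 \<and> infnorm (transpose B *v x) \<le> \<gamma>}"

definition embedded_cohesive_subset ::
    "real^'m::finite^'n::finite \<Rightarrow> real \<Rightarrow> (complex^'n) set set" where
  "embedded_cohesive_subset B \<gamma> = phase_class ` cohesive_vectors B \<gamma>"

text \<open>
  Curves on the torus are given by lifts \<open>\<theta>\<close> of their phases to \<open>\<real>\<^sup>n\<close>. The vector field is globally
  Lipschitz, so every initial condition has a solution on \<open>[0, \<infinity>)\<close>.
\<close>

definition kuramoto_solution ::
    "real^'m::finite^'n::finite \<Rightarrow> real^'m^'m \<Rightarrow> real^'n \<Rightarrow> (real \<Rightarrow> real^'n) \<Rightarrow> bool" where
  "kuramoto_solution B W \<omega> \<theta> \<longleftrightarrow> (\<forall>t\<ge>0.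
     (\<theta> has_vector_derivative (\<omega> - (B ** W) *v sin_vec (transpose B *v \<theta> t))) (at t within {0..}))"

definition synchronization_manifold ::
    "real^'m::finite^'n::finite \<Rightarrow> real^'m^'m \<Rightarrow> real^'n \<Rightarrow> (complex^'n) set \<Rightarrow> bool" where
  "synchronization_manifold B W \<omega> M \<longleftrightarrow>
     (\<exists>\<theta>. M = phase_class \<theta> \<and> \<omega> = (B ** W) *v sin_vec (transpose B *v \<theta>))"

text \<open>
  Local (asymptotic) stability of a point of the quotient for the induced dynamics: Lyapunov
  stability together with attraction of all trajectories starting in some neighbourhood.
\<close>

definition locally_stable ::
    "real^'m::finite^'n::finite \<Rightarrow> real^'m^'m \<Rightarrow> real^'n \<Rightarrow> (complex^'n) set \<Rightarrow> bool" where
  "locally_stable B W \<omega> M \<longleftrightarrow>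
     (\<forall>U. openin quotient_torus_topology U \<and> M \<in> U \<longrightarrow>
        (\<exists>V. openin quotient_torus_topology V \<and> M \<in> V \<and>
           (\<forall>\<theta>. kuramoto_solution B W \<omega> \<theta> \<and> phase_class (\<theta> 0) \<in> V \<longrightarrow>
              (\<forall>t\<ge>0. phase_class (\<theta> t) \<in> U)))) \<and>
     (\<exists>V. openin quotient_torus_topology V \<and> M \<in> V \<and>
        (\<forall>\<theta>. kuramoto_solution B W \<omega> \<theta> \<and> phase_class (\<theta> 0) \<in> V \<longrightarrow>
           limitin quotient_torus_topology (\<lambda>t. phase_class (\<theta> t)) M at_top))"

definition multi_degree :: "nat^'m::finite \<Rightarrow> nat" where
  "multi_degree \<nu> = (\<Sum>e\<in>UNIV. \<nu> $ e)"

definition multi_power :: "real^'m::finite \<Rightarrow> nat^'m \<Rightarrow> real" where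
  "multi_power x \<nu> = (\<Prod>e\<in>UNIV. x $ e ^ \<nu> $ e)"

text \<open>
  The power series with coefficients \<open>c \<nu>\<close> centred at \<open>x0\<close> converges strongly to \<open>s\<close> at \<open>x\<close>. The
  rearrangements of its terms are the bijective enumerations of the multi-indices.
\<close>

definition strongly_converges_to ::
    "(nat^'m::finite \<Rightarrow> real^'k::finite) \<Rightarrow> real^'m \<Rightarrow> real^'m \<Rightarrow> real^'k \<Rightarrow> bool" where
  "strongly_converges_to c x0 x s \<longleftrightarrow>
     (\<forall>\<pi>::nat \<Rightarrow> nat^'m. bij \<pi> \<longrightarrow> (\<lambda>k. multi_power (x - x0) (\<pi> k) *\<^sub>R c (\<pi> k)) sums s)"

text \<open>
  \<open>f\<close> is a homogeneous polynomial of order \<open>N\<close> whose coefficients are the \<open>c \<nu>\<close> with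
  \<open>multi_degree \<nu> = N\<close>.
\<close>

definition homogeneous_polynomial ::
    "nat \<Rightarrow> (nat^'m::finite \<Rightarrow> real^'k::finite) \<Rightarrow> (real^'m \<Rightarrow> real^'k) \<Rightarrow> bool" where
  "homogeneous_polynomial N c f \<longleftrightarrow>
     (\<forall>\<eta>. f \<eta> = (\<Sum>\<nu> | multi_degree \<nu> = N. multi_power \<eta> \<nu> *\<^sub>R c \<nu>))"

definition double_fact :: "nat \<Rightarrow> nat" where
  "double_fact N = (\<Prod>k<nat \<lceil>real N / 2\<rceil>. N - 2 * k)"

definition odd_tuples :: "nat \<Rightarrow> nat \<Rightarrow> nat list set" where
  "odd_tuples l N = {\<alpha>. length \<alpha> = l \<and> (\<forall>x\<in>set \<alpha>. odd x) \<and> sum_list \<alpha> = N}"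

lemma odd_tuples_nth_less:
  assumes "\<alpha> \<in> odd_tuples (2 * k + 1) N" "1 \<le> k" "j < 2 * k + 1"
  shows "\<alpha> ! j < N"
proof -
  have len: "length \<alpha> = 2 * k + 1" and sum: "sum_list \<alpha> = N" and odd: "\<forall>x\<in>set \<alpha>. odd x"
    using assms(1) by (auto simp: odd_tuples_def)
  define j' where "j' = (if j = 0 then 1 else 0 :: nat)"
  have j': "j' < length \<alpha>" "j' \<noteq> j" using assms(2) len by (auto simp: j'_def)
  have "\<alpha> ! j' > 0" using odd j'(1) by (metis nth_mem odd_pos)
  then have "\<alpha> ! j < (\<Sum>i\<in>{j, j'}. \<alpha> ! i)" using j' by simp
  also have "\<dots> \<le> (\<Sum>i<length \<alpha>. \<alpha> ! i)"
    using j' assms(3) len by (intro sum_mono2) auto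
  also have "\<dots> = N" using sum by (simp add: sum_list_sum_nth atLeast0LessThan)
  finally show ?thesis .
qed

text \<open>
  \<open>A_term P N \<eta>\<close> is \<open>A\<^sub>N(\<eta>)\<close> for odd \<open>N\<close>, where \<open>P\<close> is the cycle projection; for \<open>N = 2i + 1\<close> the bound
  \<open>N div 2\<close> is \<open>i\<close>. The value \<open>0\<close> for even \<open>N\<close> is a dummy. Multiplication on \<open>real^'m\<close>, hence
  the product over \<open>j\<close>, is the entrywise one.
\<close>

function A_term :: "real^'m^'m::finite \<Rightarrow> nat \<Rightarrow> real^'m \<Rightarrow> real^'m" where
  "A_term P N \<eta> =
     (if even N then 0
      else if N = 1 then \<eta>
      else - (P *v (\<Sum>k\<in>{1..N div 2}.
               (real (double_fact (2 * k - 1)) / (real (double_fact (2 * k)) * real (2 * k + 1))) *\<^sub>R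
               (\<Sum>\<alpha>\<in>odd_tuples (2 * k + 1) N. \<Prod>j<2 * k + 1. A_term P (\<alpha> ! j) \<eta>))))"
  by pat_completeness auto
termination
  by (relation "Wellfounded.measure (\<lambda>(P, N, \<eta>). N)") (auto intro: odd_tuples_nth_less)

declare A_term.simps [simp del]

end

theory Submission
  imports Defs
begin

text \<open>
  Write \<open>P\<close> for the cycle projection, \<open>K\<close> for its norm and \<open>u\<close> for the norm of \<open>\<eta>\<close>. A vector
  \<open>\<psi>\<close> with entries in \<open>(- 1, 1)\<close> equals \<open>sin (B\<^sup>T x)\<close> for a solution \<open>x\<close> of
  \<open>\<omega> = B \<A> sin (B\<^sup>T x)\<close> with phase differences in \<open>(- \<pi>/2, \<pi>/2)\<close> iff \<open>P (arcsin \<psi>) = 0\<close>, that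
  is, \<open>arcsin \<psi>\<close> lies in the image of \<open>B\<^sup>T\<close>, and \<open>\<psi> - P \<psi> = \<eta>\<close>. As \<open>P\<^sup>2 = P\<close> and \<open>P \<eta> = 0\<close>, the two
  conditions together are the fixed-point equation \<open>\<psi> = \<eta> - P (arcsin \<psi> - \<psi>)\<close>; existence uses the
  direction \<open>equilibrium_of_fixed_point\<close>. Expanding \<open>arcsin\<close> and comparing homogeneous parts in \<open>\<eta>\<close>,
  the formal solution of this equation is \<open>A\<^sub>1(\<eta>) + A\<^sub>3(\<eta>) + \<dots>\<close>.

  Convergence is a majorant argument. The coefficients of \<open>arcsin y - y\<close> are nonnegative, so the
  absolute values of the coefficients of each component of \<open>A\<^sub>N\<close> add up to at most \<open>b\<^sub>N\<close>, where
  \<open>\<Sum> b\<^sub>N u\<^sup>N\<close> is the formal solution of the scalar equation \<open>y = u + K (arcsin y - y)\<close>. An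
  induction bounds the partial sums of this nonnegative series by any \<open>s\<close> with \<open>0 \<le> s < 1\<close> and
  \<open>u + K (arcsin s - s) \<le> s\<close>
  (\<open>majorant_partial_sum_le\<close>). Since \<open>h K\<close> is the maximum of \<open>y - K (arcsin y - y)\<close> on \<open>[0, 1]\<close>, attained
  where \<open>arccos (K / (K + 1)) = arcsin y\<close>, the hypothesis \<open>u < h K\<close> says that \<open>u = h K'\<close> with
  \<open>K' > K\<close> (or \<open>u = 0\<close>), and \<open>s = sin \<gamma>\<^sup>*\<close> is the point at which the maximum for \<open>K'\<close> is attained;
  as \<open>K < K'\<close>, it is such an \<open>s\<close> (\<open>gamma_star_supersolution\<close>). Hence the
  multivariate series converges absolutely, may be rearranged at will, and its sum \<open>\<psi>\<close> solves the
  fixed-point equation with \<open>\<bar>\<psi>\<^sub>e\<bar> \<le> sin \<gamma>\<^sup>*\<close> (\<open>A_term_series\<close>). This gives an equilibrium in the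
  cohesive set.

  Both uniqueness and stability come from the strong monotonicity of the sine on \<open>[- \<beta>, \<beta>]\<close> for
  \<open>\<beta> < \<pi>/2\<close>: the difference of two cohesive equilibria has to vanish, and the squared distance to an
  equilibrium, measured orthogonally to the all-ones vector, decays exponentially along nearby
  trajectories (\<open>trajectory_decay\<close>). The rest is the translation between the quotient of the torus
  and lifts of the phases.
\<close>

section \<open>The function h and the angle of the cohesive set\<close>

lemma sin_le_tangent:
  fixes \<phi> \<psi> :: real
  assumes "0 \<le> \<phi>" "\<phi> \<le> pi" "0 \<le> \<psi>" "\<psi> \<le> pi"
  shows "sin \<psi> \<le> sin \<phi> + cos \<phi> * (\<psi> - \<phi>)"
proof (cases \<phi> \<psi> rule: linorder_cases)
  case less
  obtain z where z: "\<phi> < z" "z < \<psi>" "sin \<psi> - sin \<phi> = (\<psi> - \<phi>) * cos z"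
    using MVT2[of \<phi> \<psi> sin cos] less by (auto intro: DERIV_sin)
  have "cos z \<le> cos \<phi>" using z assms by (intro cos_monotone_0_pi_le) auto
  then have "(\<psi> - \<phi>) * cos z \<le> (\<psi> - \<phi>) * cos \<phi>"
    using less by (intro mult_left_mono) auto
  then show ?thesis using z by (simp add: algebra_simps)
next
  case greater
  obtain z where z: "\<psi> < z" "z < \<phi>" "sin \<phi> - sin \<psi> = (\<phi> - \<psi>) * cos z"
    using MVT2[of \<psi> \<phi> sin cos] greater by (auto intro: DERIV_sin)
  have "cos \<phi> \<le> cos z" using z assms by (intro cos_monotone_0_pi_le) auto
  then have "(\<phi> - \<psi>) * cos \<phi> \<le> (\<phi> - \<psi>) * cos z"
    using greater by (intro mult_left_mono) auto
  then show ?thesis using z by (simp add: algebra_simps)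
qed auto

text \<open>
  The value of \<open>h\<close> in terms of the angle \<open>\<phi> = arccos (x / (x + 1))\<close>.
\<close>

lemma h_angle:
  fixes x :: real
  assumes "0 \<le> x"
  defines "\<phi> \<equiv> arccos (x / (x + 1))"
  shows "cos \<phi> = x / (x + 1)" "0 < \<phi>" "\<phi> \<le> pi / 2" "h_fun x = (x + 1) * sin \<phi> - x * \<phi>"
proof -
  have q: "0 \<le> x / (x + 1)" "x / (x + 1) < 1" using assms(1) by auto
  show "cos \<phi> = x / (x + 1)" unfolding \<phi>_def using q by (intro cos_arccos) auto
  show "0 < \<phi>" unfolding \<phi>_def using q arccos_less_arccos[of "x / (x + 1)" 1] by simp
  show "\<phi> \<le> pi / 2" unfolding \<phi>_def using q arccos_le_pi2 by simp
  show "h_fun x = (x + 1) * sin \<phi> - x * \<phi>"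
    unfolding h_fun_def \<phi>_def using q by (subst sin_arccos) auto
qed

text \<open>
  The value \<open>h x\<close> is the maximum over \<open>\<psi>\<close> of \<open>(x + 1) sin \<psi> - x \<psi>\<close>; substituting
  \<open>\<psi> = arcsin y\<close>, it is the largest \<open>u\<close> for which the scalar equation
  \<open>y = u + x (arcsin y - y)\<close> has a solution.
\<close>

lemma h_fun_max:
  fixes x \<psi> :: real
  assumes "0 \<le> x" "0 \<le> \<psi>" "\<psi> \<le> pi"
  shows "(x + 1) * sin \<psi> - x * \<psi> \<le> h_fun x"
proof -
  define \<phi> where "\<phi> = arccos (x / (x + 1))"
  note \<phi> = h_angle[OF assms(1), folded \<phi>_def]
  have "sin \<psi> \<le> sin \<phi> + cos \<phi> * (\<psi> - \<phi>)"
    using \<phi> assms by (intro sin_le_tangent) auto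
  then have "(x + 1) * sin \<psi> \<le> (x + 1) * (sin \<phi> + cos \<phi> * (\<psi> - \<phi>))"
    using assms by (intro mult_left_mono) auto
  also have "\<dots> = (x + 1) * sin \<phi> + x * (\<psi> - \<phi>)"
    using assms(1) \<phi>(1) by (simp add: field_simps)
  finally show ?thesis using \<phi>(4) by (simp add: algebra_simps)
qed

lemma sin_less_arg:
  fixes x :: real
  assumes "0 < x" "x \<le> pi"
  shows "sin x < x"
proof -
  obtain z where z: "0 < z" "z < x" "sin x - sin 0 = (x - 0) * cos z"
    using MVT2[of 0 x sin cos] assms by (auto intro: DERIV_sin)
  have "cos z < cos 0" using z assms by (intro cos_monotone_0_pi) auto
  then have "x * cos z < x * 1" using assms by (intro mult_strict_left_mono) auto
  then show ?thesis using z by simp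
qed

lemma h_fun_strict_antimono:
  assumes "0 \<le> x" "x < y"
  shows "h_fun y < h_fun x"
proof -
  define \<phi> where "\<phi> = arccos (y / (y + 1))"
  have \<phi>: "0 < \<phi>" "\<phi> \<le> pi / 2" "h_fun y = (y + 1) * sin \<phi> - y * \<phi>"
    using h_angle[of y] assms unfolding \<phi>_def by auto
  have "sin \<phi> < \<phi>" using \<phi> by (intro sin_less_arg) auto
  then have "x * (\<phi> - sin \<phi>) < y * (\<phi> - sin \<phi>)"
    using assms by (intro mult_strict_right_mono) auto
  then have "h_fun y < (x + 1) * sin \<phi> - x * \<phi>" using \<phi>(3) by (simp add: algebra_simps)
  also have "\<dots> \<le> h_fun x" using \<phi> assms by (intro h_fun_max) auto
  finally show ?thesis .
qed

lemma inj_on_h_fun: "inj_on h_fun {0..}"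
  by (rule linorder_inj_onI) (auto dest: h_fun_strict_antimono)

lemma continuous_on_h_fun: "continuous_on {0..} h_fun"
proof -
  have "- 1 \<le> x / (x + 1)" if "0 \<le> x" for x :: real
    using that by (simp add: field_simps)
  then show ?thesis
    unfolding h_fun_def by (intro continuous_intros) auto
qed

text \<open>
  Any bound tending to \<open>0\<close> would do: it lets the intermediate value theorem reach every positive
  value below \<open>h K\<close>.
\<close>

lemma h_fun_le:
  assumes "0 < x"
  shows "h_fun x \<le> sqrt (2 / x)"
proof -
  define \<phi> where "\<phi> = arccos (x / (x + 1))"
  have \<phi>: "cos \<phi> = x / (x + 1)" "0 < \<phi>" "\<phi> \<le> pi / 2" "h_fun x = (x + 1) * sin \<phi> - x * \<phi>"
    using h_angle[of x] assms unfolding \<phi>_def by auto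
  have "sin \<phi> < \<phi>" using \<phi> by (intro sin_less_arg) auto
  then have "0 \<le> x * (\<phi> - sin \<phi>)" using assms by simp
  then have "h_fun x \<le> sin \<phi>" using \<phi>(4) by (simp add: algebra_simps)
  also have "sin \<phi> \<le> sqrt (2 / x)"
  proof (rule real_le_rsqrt)
    have "(sin \<phi>)\<^sup>2 = 1 - (x / (x + 1))\<^sup>2" using \<phi>(1) by (simp add: sin_squared_eq)
    also have "\<dots> = ((x + 1)\<^sup>2 - x\<^sup>2) / (x + 1)\<^sup>2"
      using assms by (simp add: diff_divide_distrib power_divide)
    also have "\<dots> = (2 * x + 1) / (x + 1)\<^sup>2"
      by (simp add: power2_eq_square algebra_simps)
    also have "\<dots> \<le> 2 / x"
    proof (rule mult_imp_div_pos_le)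
      show "2 * x + 1 \<le> 2 / x * (x + 1)\<^sup>2"
        using assms by (simp add: field_simps power2_eq_square)
    qed (use assms in auto)
    finally show "(sin \<phi>)\<^sup>2 \<le> 2 / x" .
  qed
  finally show ?thesis .
qed

lemma h_fun_surj_below:
  assumes "0 \<le> K" "0 < u" "u < h_fun K"
  obtains K' where "K < K'" "h_fun K' = u"
proof -
  define X where "X = max K (2 / u\<^sup>2)"
  have X: "K \<le> X" "2 / u\<^sup>2 \<le> X" "0 < X" using assms by (auto simp: X_def less_max_iff_disj)
  have "h_fun X \<le> sqrt (2 / X)" by (rule h_fun_le) (rule X)
  also have "\<dots> \<le> u"
  proof (rule real_le_lsqrt)
    show "2 / X \<le> u\<^sup>2" using X assms by (simp add: field_simps)
  qed (use assms in auto)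
  finally have "h_fun X \<le> u" .
  moreover have "continuous_on {K..X} h_fun"
    using assms by (intro continuous_on_subset[OF continuous_on_h_fun]) auto
  ultimately obtain K' where "K \<le> K'" "h_fun K' = u"
    using IVT2'[of h_fun X u K] X assms by auto
  moreover from this assms have "K \<noteq> K'" by auto
  ultimately show thesis using that by force
qed

text \<open>
  The sine of \<open>\<gamma>\<^sup>*\<close> is a supersolution of the scalar equation \<open>y = u + K (arcsin y - y)\<close>: writing
  \<open>u = h K'\<close>, it solves the equation with \<open>K'\<close> in place of \<open>K\<close>, and \<open>K < K'\<close>.
\<close>

lemma gamma_star_supersolution:
  assumes "0 \<le> K" "0 \<le> u" "u < h_fun K"
  defines "\<gamma> \<equiv> gamma_star u"
  shows "0 \<le> \<gamma>" "\<gamma> < pi / 2" "u + K * (\<gamma> - sin \<gamma>) \<le> sin \<gamma>"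
proof -
  have "0 \<le> \<gamma> \<and> \<gamma> < pi / 2 \<and> u + K * (\<gamma> - sin \<gamma>) \<le> sin \<gamma>"
  proof (cases "u = 0")
    case True
    then show ?thesis by (simp add: \<gamma>_def gamma_star_def)
  next
    case False
    then obtain K' where K': "K < K'" "h_fun K' = u"
      using h_fun_surj_below[of K u] assms by auto
    have "h_inv u = K'"
      unfolding h_inv_def using K' assms(1) by (intro the_inv_into_f_eq inj_on_h_fun) auto
    then have \<gamma>: "\<gamma> = arccos (K' / (K' + 1))" using False by (simp add: \<gamma>_def gamma_star_def)
    have a: "0 < \<gamma>" "u = (K' + 1) * sin \<gamma> - K' * \<gamma>" "\<gamma> \<le> pi / 2"
      using h_angle[of K'] K' assms(1) unfolding \<gamma> by auto
    have "\<gamma> < arccos 0" unfolding \<gamma> using K' assms(1) by (intro arccos_less_arccos) auto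
    then have "\<gamma> < pi / 2" by simp
    moreover have "K * (\<gamma> - sin \<gamma>) \<le> K' * (\<gamma> - sin \<gamma>)"
      using K' sin_x_le_x[of \<gamma>] a by (intro mult_right_mono) auto
    ultimately show ?thesis using a by (simp add: algebra_simps)
  qed
  then show "0 \<le> \<gamma>" "\<gamma> < pi / 2" "u + K * (\<gamma> - sin \<gamma>) \<le> sin \<gamma>" by auto
qed

section \<open>The power series of arcsin\<close>

text \<open>
  The coefficient of \<open>y\<^sup>2\<^sup>k\<^sup>+\<^sup>1\<close> in the Maclaurin series of \<open>arcsin\<close>.
\<close>

definition arcsin_coeff :: "nat \<Rightarrow> real" where
  "arcsin_coeff k = real (double_fact (2 * k - 1)) / (real (double_fact (2 * k)) * real (2 * k + 1))"

lemma double_fact_0: "double_fact 0 = 1"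
  by (simp add: double_fact_def)

lemma double_fact_rec:
  assumes "0 < N"
  shows "double_fact N = N * double_fact (N - 2)"
proof -
  have c: "nat \<lceil>real N / 2\<rceil> = Suc (nat \<lceil>real (N - 2) / 2\<rceil>)"
  proof (cases "N = 1")
    case True
    have "\<lceil>1 / 2 :: real\<rceil> = 1" by (simp add: ceiling_eq_iff)
    then show ?thesis using True by simp
  next
    case False
    then have "2 \<le> N" using assms by simp
    then have "real N / 2 = real (N - 2) / 2 + 1" by (simp add: of_nat_diff field_simps)
    then have e: "\<lceil>real N / 2\<rceil> = \<lceil>real (N - 2) / 2\<rceil> + 1"
      by (simp only: ceiling_add_one)
    moreover have "0 \<le> \<lceil>real (N - 2) / 2\<rceil>" by (simp add: le_ceiling_iff)
    ultimately show ?thesis by linarith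
  qed
  show ?thesis
    unfolding double_fact_def c prod.lessThan_Suc_shift
    by (intro arg_cong2[of _ _ _ _ "(*)"] prod.cong) auto
qed

text \<open>
  These quotients are the coefficients of the binomial series in \<open>y\<^sup>2\<close> of the derivative
  \<open>(1 - y\<^sup>2)\<^sup>-\<^sup>1\<^sup>/\<^sup>2\<close> of \<open>arcsin\<close>.
\<close>

lemma double_fact_quotient:
  "real (double_fact (2 * k - 1)) / real (double_fact (2 * k)) = (- 1) ^ k * ((- 1 / 2) gchoose k)"
proof (induction k)
  case 0
  then show ?case by (simp add: double_fact_0)
next
  case (Suc k)
  have e: "double_fact (2 * Suc k) = (2 * k + 2) * double_fact (2 * k)"
    by (subst double_fact_rec) auto
  have o: "double_fact (2 * Suc k - 1) = (2 * k + 1) * double_fact (2 * k - 1)"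
    by (subst double_fact_rec) (auto simp: algebra_simps)
  have "real (double_fact (2 * Suc k - 1)) / real (double_fact (2 * Suc k))
      = (real (2 * k + 1) / real (2 * k + 2)) * (real (double_fact (2 * k - 1)) / real (double_fact (2 * k)))"
    by (simp only: e o of_nat_mult times_divide_times_eq)
  also have "\<dots> = (real (2 * k + 1) / real (2 * k + 2)) * ((- 1) ^ k * ((- 1 / 2) gchoose k))"
    unfolding Suc.IH ..
  also have "\<dots> = (- 1) ^ Suc k * ((- 1 / 2) gchoose (Suc k))"
  proof -
    define g g' where "g = ((- 1 / 2) gchoose k :: real)" and "g' = ((- 1 / 2) gchoose (Suc k) :: real)"
    have "- 1 / 2 * g = real k * g + real (Suc k) * g'"
      unfolding g_def g'_def by (rule gbinomial_mult_1)
    then have "g' = - (real (2 * k + 1) / real (2 * k + 2)) * g"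
      by (simp add: field_simps)
    then show ?thesis unfolding g_def[symmetric] g'_def[symmetric] by simp
  qed
  finally show ?case .
qed

lemma double_fact_pos: "0 < double_fact N"
proof (induction N rule: less_induct)
  case (less N)
  show ?case
  proof (cases "N = 0")
    case False
    then have "0 < double_fact (N - 2)" using less by simp
    then show ?thesis using False by (subst double_fact_rec) auto
  qed (simp add: double_fact_0)
qed

lemma arcsin_coeff_pos: "0 < arcsin_coeff k"
  by (simp add: arcsin_coeff_def double_fact_pos)

lemma double_fact_quotient_le_1: "real (double_fact (2 * k - 1)) / real (double_fact (2 * k)) \<le> 1"
proof (induction k)
  case (Suc k)
  have e: "double_fact (2 * Suc k) = (2 * k + 2) * double_fact (2 * k)"
    by (subst double_fact_rec) auto
  have o: "double_fact (2 * Suc k - 1) = (2 * k + 1) * double_fact (2 * k - 1)"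
    by (subst double_fact_rec) (auto simp: algebra_simps)
  have "double_fact (2 * k - 1) \<le> double_fact (2 * k)"
    using Suc by (simp add: double_fact_pos divide_le_eq)
  then have "double_fact (2 * Suc k - 1) \<le> double_fact (2 * Suc k)"
    unfolding e o by (intro mult_mono) auto
  then show ?case by (simp add: divide_le_eq double_fact_pos)
qed (simp add: double_fact_0)

lemma arcsin_coeff_le_1: "arcsin_coeff k \<le> 1"
proof -
  have "arcsin_coeff k = real (double_fact (2 * k - 1)) / real (double_fact (2 * k)) / real (2 * k + 1)"
    by (simp add: arcsin_coeff_def)
  also have "\<dots> \<le> 1 / 1"
    by (intro frac_le double_fact_quotient_le_1) auto
  finally show ?thesis by simp
qed

lemma arcsin_series:
  fixes y :: real
  assumes "\<bar>y\<bar> < 1"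
  shows "(\<lambda>k. arcsin_coeff k * y ^ (2 * k + 1)) sums arcsin y"
proof -
  \<comment> \<open>the coefficients of the series in all powers of \<open>y\<close>, zero at the even ones\<close>
  define f :: "nat \<Rightarrow> real" where "f n = (if odd n then arcsin_coeff (n div 2) else 0)" for n
  define F where "F x = (\<Sum>n. f n * x ^ n)" for x
  have f1: "\<bar>f n\<bar> \<le> 1" for n
    using arcsin_coeff_le_1[of "n div 2"] arcsin_coeff_pos[of "n div 2"] by (auto simp: f_def)
  have summ: "summable (\<lambda>n. f n * x ^ n)" if "\<bar>x\<bar> < 1" for x
  proof (rule summable_comparison_test')
    show "summable (\<lambda>n. \<bar>x\<bar> ^ n)" using that by (intro summable_geometric) auto
    show "norm (f n * x ^ n) \<le> \<bar>x\<bar> ^ n" if "0 \<le> n" for n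
      using mult_right_mono[OF f1[of n], of "\<bar>x\<bar> ^ n"] by (simp add: abs_mult power_abs)
  qed
  have diffs: "diffs f n = (if even n then real (double_fact (n - 1)) / real (double_fact n) else 0)" for n
    by (auto simp: diffs_def f_def arcsin_coeff_def elim!: evenE simp del: of_nat_Suc)
  have der: "(F has_real_derivative 1 / sqrt (1 - x\<^sup>2)) (at x)" if x: "\<bar>x\<bar> < 1" for x
  proof -
    obtain r where r: "\<bar>x\<bar> < r" "r < 1" using x dense by blast
    have "(F has_real_derivative (\<Sum>n. diffs f n * x ^ n)) (at x)"
      unfolding F_def using r by (intro termdiffs_strong[of f r] summ) auto
    moreover have "(\<lambda>n. diffs f n * x ^ n) sums (1 / sqrt (1 - x\<^sup>2))"
    proof -
      have x2: "\<bar>- (x\<^sup>2)\<bar> < 1" using x by (simp add: abs_square_less_1)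
      have "(\<lambda>k. ((- 1 / 2) gchoose k) * (- (x\<^sup>2)) ^ k) sums (1 + - (x\<^sup>2)) powr (- 1 / 2)"
        using x2 by (rule gen_binomial_real)
      also have "(\<lambda>k. ((- 1 / 2) gchoose k) * (- (x\<^sup>2)) ^ k)
          = (\<lambda>k. diffs f (2 * k) * x ^ (2 * k))"
      proof
        fix k
        have "(- (x\<^sup>2)) ^ k = (- 1) ^ k * x ^ (2 * k)"
          by (simp add: power_mult power_minus[of "x\<^sup>2"])
        moreover have "diffs f (2 * k) = (- 1) ^ k * ((- 1 / 2) gchoose k)"
          unfolding diffs double_fact_quotient[symmetric] by simp
        ultimately show "((- 1 / 2) gchoose k) * (- (x\<^sup>2)) ^ k = diffs f (2 * k) * x ^ (2 * k)"
          by simp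
      qed
      also have "(1 + - (x\<^sup>2)) powr (- 1 / 2) = 1 / sqrt (1 - x\<^sup>2)"
        using x2 powr_minus_divide[of "1 - x\<^sup>2" "1 / 2"] by (simp add: powr_half_sqrt)
      finally show ?thesis
        by (subst (asm) sums_mono_reindex[of "\<lambda>k. 2 * k" "\<lambda>n. diffs f n * x ^ n"])
          (auto simp: strict_mono_def diffs elim!: evenE)
    qed
    ultimately show ?thesis by (simp add: sums_iff)
  qed
  have "F y - arcsin y = F 0 - arcsin 0"
  proof (rule has_field_derivative_zero_constant[of "{-1<..<1}" "\<lambda>x. F x - arcsin x", THEN exE])
    fix x :: real assume "x \<in> {-1<..<1}"
    then have x: "\<bar>x\<bar> < 1" by auto
    have "(arcsin has_real_derivative inverse (sqrt (1 - x\<^sup>2))) (at x)"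
      using x by (intro DERIV_arcsin) auto
    with der[OF x] have "((\<lambda>x. F x - arcsin x) has_real_derivative
        1 / sqrt (1 - x\<^sup>2) - inverse (sqrt (1 - x\<^sup>2))) (at x)"
      by (rule DERIV_diff)
    then show "((\<lambda>x. F x - arcsin x) has_real_derivative 0) (at x within {-1<..<1})"
      by (simp add: inverse_eq_divide has_field_derivative_at_within)
  next
    fix c assume "\<forall>x\<in>{-1<..<1}. F x - arcsin x = c"
    note c = this
    have "F y - arcsin y = c" using assms by (intro bspec[OF c]) auto
    moreover have "F 0 - arcsin 0 = c" by (intro bspec[OF c]) auto
    ultimately show ?thesis by simp
  qed auto
  moreover have "F 0 = 0" unfolding F_def by (simp add: f_def)
  ultimately have "F y = arcsin y" by simp
  then have "(\<lambda>n. f n * y ^ n) sums arcsin y"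
    using summ[OF assms] unfolding F_def by (simp add: sums_iff)
  moreover have "(\<lambda>k. arcsin_coeff k * y ^ (2 * k + 1)) = (\<lambda>k. f (2 * k + 1) * y ^ (2 * k + 1))"
    by (simp add: f_def)
  moreover have "f n * y ^ n = 0" if "n \<notin> range (\<lambda>k. 2 * k + 1)" for n
    using that by (cases "even n") (auto simp: f_def elim!: oddE)
  then have "(\<lambda>k. f (2 * k + 1) * y ^ (2 * k + 1)) sums arcsin y \<longleftrightarrow> (\<lambda>n. f n * y ^ n) sums arcsin y"
    by (intro sums_mono_reindex[of "\<lambda>k. 2 * k + 1" "\<lambda>n. f n * y ^ n"]) (auto simp: strict_mono_def)
  ultimately show ?thesis by simp
qed

section \<open>Homogeneous terms and their scalar majorant\<close>

lemma finite_odd_tuples: "finite (odd_tuples l N)"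
proof (rule finite_subset)
  show "odd_tuples l N \<subseteq> {\<alpha>. set \<alpha> \<subseteq> {..N} \<and> length \<alpha> = l}"
    using member_le_sum_list by (fastforce simp: odd_tuples_def)
qed (simp add: finite_lists_length_eq)

lemma odd_tuples_eq_empty:
  assumes "N < l"
  shows "odd_tuples l N = {}"
proof -
  have "length \<alpha> \<le> sum_list \<alpha>" if "\<forall>x\<in>set \<alpha>. odd x" for \<alpha> :: "nat list"
    using that by (induction \<alpha>) (auto elim!: oddE)
  then show ?thesis using assms by (fastforce simp: odd_tuples_def)
qed

lemma odd_tuples_sum_nth: "\<alpha> \<in> odd_tuples l N \<Longrightarrow> (\<Sum>j<l. \<alpha> ! j) = N"
  by (auto simp: odd_tuples_def sum_list_sum_nth atLeast0LessThan)

lemma even_sum_list_odd: "\<forall>x\<in>set \<alpha>. odd x \<Longrightarrow> even (sum_list \<alpha>) = even (length \<alpha>)" for \<alpha> :: "nat list"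
  by (induction \<alpha>) auto

lemma odd_tuples_even_eq_empty: "even N \<Longrightarrow> odd l \<Longrightarrow> odd_tuples l N = {}"
  using even_sum_list_odd by (fastforce simp: odd_tuples_def)

text \<open>
  The degree-\<open>N\<close> part of \<open>arcsin z - z\<close> when \<open>z\<close> has only parts of odd degree and \<open>X j\<close> is the one
  of degree \<open>j\<close>; values of \<open>X\<close> at even arguments are ignored.
\<close>

definition arcsin_part :: "(nat \<Rightarrow> real) \<Rightarrow> nat \<Rightarrow> real" where
  "arcsin_part X N =
     (\<Sum>k\<in>{1..N div 2}. arcsin_coeff k * (\<Sum>\<alpha>\<in>odd_tuples (2 * k + 1) N. \<Prod>j<2 * k + 1. X (\<alpha> ! j)))"

lemma arcsin_part_even: "even N \<Longrightarrow> arcsin_part X N = 0"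
  by (simp add: arcsin_part_def odd_tuples_even_eq_empty)

lemma arcsin_part_1: "arcsin_part X 1 = 0"
  by (simp add: arcsin_part_def)

lemma prod_vec_component: "(\<Prod>j\<in>A. v j :: real^'m::finite) $ e = (\<Prod>j\<in>A. v j $ e)"
  by (induction A rule: infinite_finite_induct) auto

text \<open>
  The recursion in one component. It holds for all \<open>N\<close>, because \<open>arcsin_part\<close> vanishes at \<open>1\<close> and
  at even degrees.
\<close>

lemma A_term_component:
  "A_term P N \<eta> $ e = (if N = 1 then \<eta> $ e else 0) -
     (\<Sum>f\<in>UNIV. P $ e $ f * arcsin_part (\<lambda>n. A_term P n \<eta> $ f) N)"
proof -
  consider "even N" | "N = 1" | "odd N" "N \<noteq> 1" by blast
  then show ?thesis
  proof cases
    case 1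
    then show ?thesis by (subst A_term.simps) (auto simp: arcsin_part_even)
  next
    case 2
    then show ?thesis by (subst A_term.simps) (auto simp: arcsin_part_1[simplified])
  next
    case 3
    then show ?thesis
      by (subst A_term.simps)
        (simp add: matrix_vector_mult_def prod_vec_component arcsin_part_def arcsin_coeff_def)
  qed
qed

text \<open>
  The scalar majorant: the recursion for \<open>A_term\<close> in one variable \<open>\<eta> = 1\<close>, with \<open>- P\<close> replaced by a
  bound \<open>K\<close> on its norm.
\<close>

function majorant :: "real \<Rightarrow> nat \<Rightarrow> real" where
  "majorant K N =
     (if even N then 0
      else if N = 1 then 1
      else K * (\<Sum>k\<in>{1..N div 2}. arcsin_coeff k *
        (\<Sum>\<alpha>\<in>odd_tuples (2 * k + 1) N. \<Prod>j<2 * k + 1. majorant K (\<alpha> ! j))))"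
  by pat_completeness auto
termination
  by (relation "Wellfounded.measure (\<lambda>(K, N). N)") (auto intro: odd_tuples_nth_less)

declare majorant.simps [simp del]

lemma majorant_rec: "majorant K N = (if N = 1 then 1 else 0) + K * arcsin_part (majorant K) N"
proof -
  consider "even N" | "N = 1" | "odd N" "N \<noteq> 1" by blast
  then show ?thesis
  proof cases
    case 1
    then show ?thesis by (subst majorant.simps) (auto simp: arcsin_part_even)
  next
    case 2
    then show ?thesis by (subst majorant.simps) (auto simp: arcsin_part_1[simplified])
  next
    case 3
    then show ?thesis by (subst majorant.simps) (simp add: arcsin_part_def)
  qed
qed

lemma majorant_nonneg:
  assumes "0 \<le> K"
  shows "0 \<le> majorant K N"
proof (induction N rule: less_induct)
  case (less N)
  have "0 \<le> arcsin_part (majorant K) N"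
    unfolding arcsin_part_def using less odd_tuples_nth_less
    by (intro sum_nonneg mult_nonneg_nonneg prod_nonneg) (auto simp: less_imp_le[OF arcsin_coeff_pos])
  then show ?case using assms by (subst majorant_rec) auto
qed

lemma finite_multi_degree: "finite {\<nu> :: nat^'m::finite. multi_degree \<nu> = N}"
proof (rule finite_subset)
  show "{\<nu> :: nat^'m. multi_degree \<nu> = N} \<subseteq> vec_lambda ` (\<Pi>\<^sub>E e\<in>UNIV. {..N})"
  proof
    fix \<nu> :: "nat^'m" assume "\<nu> \<in> {\<nu>. multi_degree \<nu> = N}"
    then have "(\<Sum>e\<in>UNIV. \<nu> $ e) = N" by (simp add: multi_degree_def)
    then have "\<nu> $ e \<le> N" for e
      using member_le_sum[of e UNIV "\<lambda>e. \<nu> $ e"] by auto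
    then have "vec_nth \<nu> \<in> (\<Pi>\<^sub>E e\<in>UNIV. {..N})" by auto
    moreover have "\<nu> = vec_lambda (vec_nth \<nu>)" by simp
    ultimately show "\<nu> \<in> vec_lambda ` (\<Pi>\<^sub>E e\<in>UNIV. {..N})" by blast
  qed
qed (intro finite_imageI finite_PiE; simp)

lemma multi_degree_add: "multi_degree (\<mu> + \<nu>) = multi_degree \<mu> + multi_degree \<nu>"
  by (simp add: multi_degree_def sum.distrib)

lemma multi_power_add: "multi_power x (\<mu> + \<nu>) = multi_power x \<mu> * multi_power x \<nu>"
  by (simp add: multi_power_def power_add prod.distrib)

lemma multi_power_bound:
  assumes "\<And>e. \<bar>x $ e\<bar> \<le> u" "multi_degree \<nu> = N"
  shows "\<bar>multi_power x \<nu>\<bar> \<le> u ^ N"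
proof -
  have "\<bar>multi_power x \<nu>\<bar> = (\<Prod>e\<in>UNIV. \<bar>x $ e\<bar> ^ \<nu> $ e)"
    by (simp add: multi_power_def abs_prod power_abs)
  also have "\<dots> \<le> (\<Prod>e\<in>UNIV. u ^ \<nu> $ e)"
    using assms(1) by (intro prod_mono) (auto intro: power_mono)
  also have "\<dots> = u ^ N"
    using assms(2) by (simp add: power_sum[symmetric] multi_degree_def)
  finally show ?thesis .
qed

text \<open>
  The real function \<open>f\<close> is a homogeneous polynomial of degree \<open>N\<close> whose coefficients have absolute
  values adding up to at most \<open>b\<close>.
\<close>

definition bounded_form :: "nat \<Rightarrow> (real^'m::finite \<Rightarrow> real) \<Rightarrow> real \<Rightarrow> bool" where
  "bounded_form N f b \<longleftrightarrow>
     (\<exists>c. (\<forall>\<eta>. f \<eta> = (\<Sum>\<nu> | multi_degree \<nu> = N. c \<nu> * multi_power \<eta> \<nu>)) \<and>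
          (\<Sum>\<nu> | multi_degree \<nu> = N. \<bar>c \<nu>\<bar>) \<le> b)"

lemma bounded_form_mono: "bounded_form N f b \<Longrightarrow> b \<le> b' \<Longrightarrow> bounded_form N f b'"
  unfolding bounded_form_def by (meson order_trans)

lemma bounded_form_0: "bounded_form N (\<lambda>_. 0) 0"
  unfolding bounded_form_def by (rule exI[of _ "\<lambda>_. 0"]) auto

lemma bounded_form_single:
  fixes \<mu> :: "nat^'m::finite"
  shows "bounded_form (multi_degree \<mu>) (\<lambda>\<eta>. multi_power \<eta> \<mu>) 1"
  unfolding bounded_form_def
  by (rule exI[of _ "\<lambda>\<nu>. if \<nu> = \<mu> then 1 else 0"])
    (simp add: if_distrib[of abs] if_distrib[of "\<lambda>c. c * _"] finite_multi_degree cong: if_cong)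

lemma bounded_form_coordinate: "bounded_form 1 (\<lambda>\<eta>. \<eta> $ e) 1"
proof -
  have "multi_power \<eta> (axis e 1) = \<eta> $ e" for \<eta> :: "real^'a"
    by (simp add: multi_power_def axis_def if_distrib[of "\<lambda>n. _ ^ n"] cong: if_cong)
  moreover have "multi_degree (axis e 1 :: nat^'a) = 1"
    by (simp add: multi_degree_def axis_def)
  ultimately show ?thesis using bounded_form_single[of "axis e 1"] by simp
qed

lemma bounded_form_1: "bounded_form 0 (\<lambda>_. 1) 1"
  using bounded_form_single[of 0] by (simp add: multi_power_def multi_degree_def)

lemma bounded_form_add:
  assumes "bounded_form N f b" "bounded_form N g b'"
  shows "bounded_form N (\<lambda>\<eta>. f \<eta> + g \<eta>) (b + b')"
proof -
  obtain c c' where c: "\<And>\<eta>. f \<eta> = (\<Sum>\<nu> | multi_degree \<nu> = N. c \<nu> * multi_power \<eta> \<nu>)"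
      "(\<Sum>\<nu> | multi_degree \<nu> = N. \<bar>c \<nu>\<bar>) \<le> b"
    and c': "\<And>\<eta>. g \<eta> = (\<Sum>\<nu> | multi_degree \<nu> = N. c' \<nu> * multi_power \<eta> \<nu>)"
      "(\<Sum>\<nu> | multi_degree \<nu> = N. \<bar>c' \<nu>\<bar>) \<le> b'"
    using assms unfolding bounded_form_def by auto
  have "(\<Sum>\<nu> | multi_degree \<nu> = N. \<bar>c \<nu> + c' \<nu>\<bar>)
      \<le> (\<Sum>\<nu> | multi_degree \<nu> = N. \<bar>c \<nu>\<bar> + \<bar>c' \<nu>\<bar>)"
    by (intro sum_mono) auto
  also have "\<dots> \<le> b + b'" using c(2) c'(2) by (simp add: sum.distrib)
  finally show ?thesis
    unfolding bounded_form_def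
    by (intro exI[of _ "\<lambda>\<nu>. c \<nu> + c' \<nu>"]) (simp add: c(1) c'(1) sum.distrib algebra_simps)
qed

lemma bounded_form_scale:
  assumes "bounded_form N f b"
  shows "bounded_form N (\<lambda>\<eta>. r * f \<eta>) (\<bar>r\<bar> * b)"
proof -
  obtain c where c: "\<And>\<eta>. f \<eta> = (\<Sum>\<nu> | multi_degree \<nu> = N. c \<nu> * multi_power \<eta> \<nu>)"
      "(\<Sum>\<nu> | multi_degree \<nu> = N. \<bar>c \<nu>\<bar>) \<le> b"
    using assms unfolding bounded_form_def by auto
  show ?thesis
    unfolding bounded_form_def using mult_left_mono[OF c(2), of "\<bar>r\<bar>"]
    by (intro exI[of _ "\<lambda>\<nu>. r * c \<nu>"]) (simp add: c(1) sum_distrib_left abs_mult mult.assoc)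
qed

lemma bounded_form_sum:
  assumes "\<And>i. i \<in> I \<Longrightarrow> bounded_form N (f i) (b i)"
  shows "bounded_form N (\<lambda>\<eta>. \<Sum>i\<in>I. f i \<eta>) (\<Sum>i\<in>I. b i)"
  using assms
  by (induction I rule: infinite_finite_induct) (auto intro: bounded_form_0 bounded_form_add)

lemma bounded_form_mult:
  fixes f g :: "real^'m::finite \<Rightarrow> real"
  assumes "bounded_form M f b" "bounded_form N g b'"
  shows "bounded_form (M + N) (\<lambda>\<eta>. f \<eta> * g \<eta>) (b * b')"
proof -
  define D where "D N = {\<nu> :: nat^'m. multi_degree \<nu> = N}" for N
  have fin: "finite (D N)" for N unfolding D_def by (rule finite_multi_degree)
  obtain c c' where c: "\<And>\<eta>. f \<eta> = (\<Sum>\<nu>\<in>D M. c \<nu> * multi_power \<eta> \<nu>)"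
      "(\<Sum>\<nu>\<in>D M. \<bar>c \<nu>\<bar>) \<le> b"
    and c': "\<And>\<eta>. g \<eta> = (\<Sum>\<nu>\<in>D N. c' \<nu> * multi_power \<eta> \<nu>)"
      "(\<Sum>\<nu>\<in>D N. \<bar>c' \<nu>\<bar>) \<le> b'"
    using assms unfolding bounded_form_def D_def by auto
  define S where "S \<nu> = {p \<in> D M \<times> D N. fst p + snd p = \<nu>}" for \<nu>
  define C where "C \<nu> = (\<Sum>p\<in>S \<nu>. c (fst p) * c' (snd p))" for \<nu>
  have group: "(\<Sum>\<nu>\<in>D (M + N). \<Sum>p\<in>S \<nu>. h p) = (\<Sum>p\<in>D M \<times> D N. h p)" for h :: "_ \<Rightarrow> real"
    unfolding S_def using fin by (intro sum.group) (auto simp: D_def multi_degree_add)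
  have "f \<eta> * g \<eta> = (\<Sum>\<nu>\<in>D (M + N). C \<nu> * multi_power \<eta> \<nu>)" for \<eta>
  proof -
    have "f \<eta> * g \<eta> = (\<Sum>p\<in>D M \<times> D N. c (fst p) * c' (snd p) * multi_power \<eta> (fst p + snd p))"
      unfolding c c' sum_product sum.cartesian_product
      by (intro sum.cong) (auto simp: multi_power_add)
    also have "\<dots> = (\<Sum>\<nu>\<in>D (M + N). \<Sum>p\<in>S \<nu>. c (fst p) * c' (snd p) * multi_power \<eta> (fst p + snd p))"
      by (rule group[symmetric])
    also have "\<dots> = (\<Sum>\<nu>\<in>D (M + N). C \<nu> * multi_power \<eta> \<nu>)"
      unfolding C_def sum_distrib_right by (intro sum.cong) (auto simp: S_def)
    finally show ?thesis .
  qed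
  moreover have "(\<Sum>\<nu>\<in>D (M + N). \<bar>C \<nu>\<bar>) \<le> b * b'"
  proof -
    have "(\<Sum>\<nu>\<in>D (M + N). \<bar>C \<nu>\<bar>) \<le> (\<Sum>\<nu>\<in>D (M + N). \<Sum>p\<in>S \<nu>. \<bar>c (fst p)\<bar> * \<bar>c' (snd p)\<bar>)"
      unfolding C_def by (intro sum_mono order_trans[OF sum_abs]) (simp add: abs_mult)
    also have "\<dots> = (\<Sum>\<nu>\<in>D M. \<bar>c \<nu>\<bar>) * (\<Sum>\<nu>\<in>D N. \<bar>c' \<nu>\<bar>)"
      unfolding group sum_product sum.cartesian_product by (intro sum.cong) auto
    also have "\<dots> \<le> b * b'"
      using c(2) c'(2) by (intro mult_mono) (auto intro: sum_nonneg order_trans[OF sum_nonneg])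
    finally show ?thesis .
  qed
  ultimately show ?thesis unfolding bounded_form_def D_def by blast
qed

lemma bounded_form_prod:
  fixes n :: nat
  assumes "\<And>j. j < n \<Longrightarrow> bounded_form (N j) (f j) (b j)"
  shows "bounded_form (\<Sum>j<n. N j) (\<lambda>\<eta>. \<Prod>j<n. f j \<eta>) (\<Prod>j<n. b j)"
  using assms by (induction n) (auto intro: bounded_form_1 bounded_form_mult)

lemma bounded_form_arcsin_part:
  assumes "\<And>n. n < N \<Longrightarrow> bounded_form n (X n) (b n)"
  shows "bounded_form N (\<lambda>\<eta>. arcsin_part (\<lambda>n. X n \<eta>) N) (arcsin_part b N)"
  unfolding arcsin_part_def
proof (intro bounded_form_sum)
  fix k assume k: "k \<in> {1..N div 2}"
  have "bounded_form N (\<lambda>\<eta>. \<Prod>j<2 * k + 1. X (\<alpha> ! j) \<eta>) (\<Prod>j<2 * k + 1. b (\<alpha> ! j))"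
    if \<alpha>: "\<alpha> \<in> odd_tuples (2 * k + 1) N" for \<alpha>
    using bounded_form_prod[of "2 * k + 1" "\<lambda>j. \<alpha> ! j" "\<lambda>j. X (\<alpha> ! j)" "\<lambda>j. b (\<alpha> ! j)"]
      odd_tuples_sum_nth[OF \<alpha>] assms odd_tuples_nth_less[OF \<alpha>] k by auto
  from bounded_form_scale[OF bounded_form_sum[OF this], where r = "arcsin_coeff k"]
  show "bounded_form N (\<lambda>\<eta>. arcsin_coeff k *
          (\<Sum>\<alpha>\<in>odd_tuples (2 * k + 1) N. \<Prod>j<2 * k + 1. X (\<alpha> ! j) \<eta>))
        (arcsin_coeff k * (\<Sum>\<alpha>\<in>odd_tuples (2 * k + 1) N. \<Prod>j<2 * k + 1. b (\<alpha> ! j)))"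
    using arcsin_coeff_pos[of k] by simp
qed

lemma arcsin_part_nonneg:
  assumes "\<And>n. 0 \<le> X n"
  shows "0 \<le> arcsin_part X N"
  unfolding arcsin_part_def using assms arcsin_coeff_pos less_imp_le
  by (intro sum_nonneg mult_nonneg_nonneg prod_nonneg) blast+

lemma bounded_form_A_term:
  fixes P :: "real^'m^'m::finite"
  assumes K: "\<And>e. (\<Sum>f\<in>UNIV. \<bar>P $ e $ f\<bar>) \<le> K"
  shows "bounded_form N (\<lambda>\<eta>. A_term P N \<eta> $ e) (majorant K N)"
proof (induction N arbitrary: e rule: less_induct)
  case (less N)
  have K0: "0 \<le> K" using K[of undefined] by (meson abs_ge_zero order_trans sum_nonneg)
  define M where "M = arcsin_part (majorant K) N"
  have M0: "0 \<le> M" unfolding M_def by (rule arcsin_part_nonneg) (rule majorant_nonneg[OF K0])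
  have "bounded_form N (\<lambda>\<eta>. if N = 1 then \<eta> $ e else 0) (if N = 1 then 1 else 0)"
    using bounded_form_coordinate[of e] bounded_form_0 by auto
  moreover have "bounded_form N (\<lambda>\<eta>. arcsin_part (\<lambda>n. A_term P n \<eta> $ f) N) M" for f
    unfolding M_def using less by (intro bounded_form_arcsin_part) auto
  then have "bounded_form N (\<lambda>\<eta>. \<Sum>f\<in>UNIV. - P $ e $ f * arcsin_part (\<lambda>n. A_term P n \<eta> $ f) N)
      (\<Sum>f\<in>UNIV. \<bar>- P $ e $ f\<bar> * M)"
    by (intro bounded_form_sum bounded_form_scale)
  then have "bounded_form N (\<lambda>\<eta>. \<Sum>f\<in>UNIV. - P $ e $ f * arcsin_part (\<lambda>n. A_term P n \<eta> $ f) N) (K * M)"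
  proof (rule bounded_form_mono)
    show "(\<Sum>f\<in>UNIV. \<bar>- P $ e $ f\<bar> * M) \<le> K * M"
      using mult_right_mono[OF K[of e] M0] by (simp add: sum_distrib_right)
  qed
  ultimately have "bounded_form N (\<lambda>\<eta>. (if N = 1 then \<eta> $ e else 0) +
      (\<Sum>f\<in>UNIV. - P $ e $ f * arcsin_part (\<lambda>n. A_term P n \<eta> $ f) N)) ((if N = 1 then 1 else 0) + K * M)"
    by (rule bounded_form_add)
  also have "(if N = 1 then 1 else 0) + K * M = majorant K N"
    unfolding M_def by (rule majorant_rec[symmetric])
  also have "(\<lambda>\<eta>. (if N = 1 then \<eta> $ e else 0) +
      (\<Sum>f\<in>UNIV. - P $ e $ f * arcsin_part (\<lambda>n. A_term P n \<eta> $ f) N)) = (\<lambda>\<eta>. A_term P N \<eta> $ e)"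
    by (subst A_term_component) (simp add: sum_negf)
  finally show ?case .
qed

text \<open>
  A multi-index determines its degree, so one family of coefficients serves all \<open>A_term P N\<close>.
\<close>

lemma A_term_coefficients:
  fixes P :: "real^'m^'m::finite"
  assumes K: "\<And>e. (\<Sum>f\<in>UNIV. \<bar>P $ e $ f\<bar>) \<le> K"
  obtains c where "\<And>N. homogeneous_polynomial N c (A_term P N)"
    "\<And>N e. (\<Sum>\<nu> | multi_degree \<nu> = N. \<bar>c \<nu> $ e\<bar>) \<le> majorant K N"
    "\<And>\<nu>. even (multi_degree \<nu>) \<Longrightarrow> c \<nu> = 0"
proof -
  have K0: "0 \<le> K" using K[of undefined] by (meson abs_ge_zero order_trans sum_nonneg)
  define cc where "cc N e = (SOME c. (\<forall>\<eta>. A_term P N \<eta> $ e = (\<Sum>\<nu> | multi_degree \<nu> = N. c \<nu> * multi_power \<eta> \<nu>)) \<and>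
          (\<Sum>\<nu> | multi_degree \<nu> = N. \<bar>c \<nu>\<bar>) \<le> majorant K N)" for N e
  have cc: "A_term P N \<eta> $ e = (\<Sum>\<nu> | multi_degree \<nu> = N. cc N e \<nu> * multi_power \<eta> \<nu>)"
      "(\<Sum>\<nu> | multi_degree \<nu> = N. \<bar>cc N e \<nu>\<bar>) \<le> majorant K N" for N e \<eta>
    using someI_ex[OF bounded_form_A_term[OF K, of N e, unfolded bounded_form_def]]
    unfolding cc_def[symmetric] by auto
  define c where "c \<nu> = (if even (multi_degree \<nu>) then 0 else (\<chi> e. cc (multi_degree \<nu>) e \<nu>))" for \<nu>
  show thesis
  proof
    show "homogeneous_polynomial N c (A_term P N)" for N
      unfolding homogeneous_polynomial_def
    proof
      fix \<eta>
      show "A_term P N \<eta> = (\<Sum>\<nu> | multi_degree \<nu> = N. multi_power \<eta> \<nu> *\<^sub>R c \<nu>)"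
      proof (cases "even N")
        case True
        then show ?thesis by (subst A_term.simps) (simp add: c_def)
      next
        case False
        then show ?thesis by (simp add: vec_eq_iff c_def cc(1) mult.commute)
      qed
    qed
    show "(\<Sum>\<nu> | multi_degree \<nu> = N. \<bar>c \<nu> $ e\<bar>) \<le> majorant K N" for N e
      using cc(2)[of N e] majorant_nonneg[OF K0, of N] by (cases "even N") (auto simp: c_def)
    show "c \<nu> = 0" if "even (multi_degree \<nu>)" for \<nu>
      using that by (simp add: c_def)
  qed
qed

section \<open>Absolute convergence and the fixed-point equation\<close>

text \<open>
  The expansion of a power of an unconditionally convergent series of reals into a sum over lists.
\<close>

lemma power_has_sum_lists:
  fixes f :: "'a \<Rightarrow> real"
  assumes f: "f summable_on A"
  shows "((\<lambda>\<alpha>. \<Prod>j<l. f (\<alpha> ! j)) has_sum (infsum f A) ^ l) {\<alpha>. set \<alpha> \<subseteq> A \<and> length \<alpha> = l}"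
  (is "(?p l has_sum _) (?L l)")
proof -
  have "(\<lambda>\<alpha>. norm (?p l \<alpha>)) summable_on ?L l \<and> (?p l has_sum (infsum f A) ^ l) (?L l)"
  proof (induction l)
    case 0
    have "?L 0 = {[]}" by auto
    then show ?case by (simp only:) (simp add: has_sum_finite_iff)
  next
    case (Suc l)
    define g where "g = (\<lambda>(x, \<alpha>). f x * ?p l \<alpha>)"
    have bij: "bij_betw (\<lambda>(x, \<alpha>). x # \<alpha>) (A \<times> ?L l) (?L (Suc l))"
    proof (rule bij_betwI[where g = "\<lambda>\<alpha>. (hd \<alpha>, tl \<alpha>)"])
      show "(\<lambda>\<alpha>. (hd \<alpha>, tl \<alpha>)) \<in> ?L (Suc l) \<rightarrow> A \<times> ?L l"
      proof
        fix \<alpha> assume "\<alpha> \<in> ?L (Suc l)"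
        then show "(hd \<alpha>, tl \<alpha>) \<in> A \<times> ?L l" by (cases \<alpha>) auto
      qed
      show "(case (hd \<alpha>, tl \<alpha>) of (x, \<alpha>) \<Rightarrow> x # \<alpha>) = \<alpha>" if "\<alpha> \<in> ?L (Suc l)" for \<alpha>
        using that by (cases \<alpha>) auto
    qed auto
    have cons: "?p (Suc l) (case p of (x, \<alpha>) \<Rightarrow> x # \<alpha>) = g p" for p
      by (cases p) (simp add: g_def prod.lessThan_Suc_shift del: prod.lessThan_Suc)
    have "(\<lambda>p. norm (g p)) summable_on A \<times> ?L l"
      unfolding Infinite_Sum.abs_summable_on_Sigma_iff
    proof (intro conjI ballI)
      show "(\<lambda>\<alpha>. norm (g (x, \<alpha>))) summable_on ?L l" if "x \<in> A" for x
        using Suc.IH summable_on_cmult_right[of "\<lambda>\<alpha>. norm (?p l \<alpha>)" "?L l" "norm (f x)"]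
        by (simp add: g_def abs_mult)
      have inf: "infsum (\<lambda>\<alpha>. norm (g (x, \<alpha>))) (?L l) = norm (f x) * infsum (\<lambda>\<alpha>. norm (?p l \<alpha>)) (?L l)" for x
        by (simp add: g_def abs_mult infsum_cmult_right')
      have "(\<lambda>x. norm (f x)) summable_on A"
        using f by (rule summable_on_iff_abs_summable_on_real[THEN iffD1])
      then show "(\<lambda>x. norm (infsum (\<lambda>\<alpha>. norm (g (x, \<alpha>))) (?L l))) summable_on A"
        unfolding inf by (simp add: abs_mult summable_on_cmult_left)
    qed
    note sg = this abs_summable_summable[OF this]
    have "(g has_sum (infsum f A * infsum f A ^ l)) (A \<times> ?L l)"
    proof (rule has_sum_SigmaI)
      show "((\<lambda>\<alpha>. g (x, \<alpha>)) has_sum (f x * infsum f A ^ l)) (?L l)" if "x \<in> A" for x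
        using Suc.IH by (auto simp: g_def intro: has_sum_cmult_right)
      show "((\<lambda>x. f x * infsum f A ^ l) has_sum (infsum f A * infsum f A ^ l)) A"
        using f by (intro has_sum_cmult_left has_sum_infsum)
    qed (rule sg)
    then have "(?p (Suc l) has_sum (infsum f A ^ Suc l)) (?L (Suc l))"
      using has_sum_reindex_bij_betw[OF bij, of "?p (Suc l)"] by (simp only: cons power_Suc)
    moreover have "(\<lambda>\<alpha>. norm (?p (Suc l) \<alpha>)) summable_on ?L (Suc l)"
      using summable_on_reindex_bij_betw[OF bij, of "\<lambda>\<alpha>. norm (?p (Suc l) \<alpha>)"] sg(1)
      by (simp only: cons)
    ultimately show ?case by blast
  qed
  then show ?thesis by blast
qed

lemma arcsin_series_tail:
  fixes y :: real
  assumes "\<bar>y\<bar> < 1"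
  shows "((\<lambda>k. arcsin_coeff k * y ^ (2 * k + 1)) has_sum (arcsin y - y)) {1..}"
proof -
  have c0: "arcsin_coeff 0 = 1" by (simp add: arcsin_coeff_def double_fact_0)
  have "norm (arcsin_coeff k * y ^ (2 * k + 1)) = arcsin_coeff k * \<bar>y\<bar> ^ (2 * k + 1)" for k
    using arcsin_coeff_pos[of k] by (simp add: abs_mult power_abs)
  then have "summable (\<lambda>k. norm (arcsin_coeff k * y ^ (2 * k + 1)))"
    using arcsin_series[of "\<bar>y\<bar>", THEN sums_summable] assms by simp
  then have "((\<lambda>k. arcsin_coeff k * y ^ (2 * k + 1)) has_sum arcsin y) UNIV"
    using arcsin_series[OF assms] by (rule norm_summable_imp_has_sum)
  then have "((\<lambda>k. arcsin_coeff k * y ^ (2 * k + 1)) has_sum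
      (arcsin y - (\<Sum>k\<in>{0}. arcsin_coeff k * y ^ (2 * k + 1)))) (UNIV - {0})"
    by (intro has_sum_Diff has_sum_finite) auto
  moreover have "UNIV - {0} = {1::nat..}" by auto
  ultimately show ?thesis by (simp add: c0)
qed

lemma arcsin_part_eq_sum_Sigma:
  "arcsin_part X N = (\<Sum>(k, \<alpha>)\<in>Sigma {1..N div 2} (\<lambda>k. odd_tuples (2 * k + 1) N).
     arcsin_coeff k * (\<Prod>j<2 * k + 1. X (\<alpha> ! j)))"
  unfolding arcsin_part_def sum_distrib_left
  by (intro sum.Sigma) (simp_all add: finite_odd_tuples)

text \<open>
  Rearrangement: for an absolutely convergent series \<open>\<Sum>X N\<close> over odd \<open>N\<close>, grouping the products
  in the expansion of \<open>arcsin z - z\<close> at \<open>z = \<Sum>X N\<close> by total degree does not change the sum.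
\<close>

lemma arcsin_part_has_sum:
  fixes X :: "nat \<Rightarrow> real"
  assumes summable: "(\<lambda>N. \<bar>X N\<bar>) summable_on {N. odd N}"
    and less_1: "(\<Sum>\<^sub>\<infinity>N | odd N. \<bar>X N\<bar>) < 1"
  defines "z \<equiv> \<Sum>\<^sub>\<infinity>N | odd N. X N"
  shows "(arcsin_part X has_sum (arcsin z - z)) UNIV"
proof -
  define Od where "Od = {N::nat. odd N}"
  define lst where "lst k = {\<alpha>. set \<alpha> \<subseteq> Od \<and> length \<alpha> = 2 * k + 1}" for k
  define T where "T = Sigma {1..} lst"
  define g where "g = (\<lambda>(k, \<alpha>). arcsin_coeff k * (\<Prod>j<2 * k + 1. X (\<alpha> ! j)))"
  define s where "s = (\<Sum>\<^sub>\<infinity>N\<in>Od. \<bar>X N\<bar>)"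
  have XO: "X summable_on Od"
    using summable by (subst summable_on_iff_abs_summable_on_real) (simp add: Od_def)
  have s0: "0 \<le> s" unfolding s_def by (intro infsum_nonneg) auto
  have s1: "s < 1" using less_1 by (simp add: s_def Od_def)
  have "\<bar>z\<bar> \<le> s"
    using norm_infsum_bound[of X Od] summable by (simp add: z_def s_def Od_def)
  then have z1: "\<bar>z\<bar> < 1" using s1 by simp
  have inner: "((\<lambda>\<alpha>. g (k, \<alpha>)) has_sum (arcsin_coeff k * z ^ (2 * k + 1))) (lst k)" for k
    unfolding g_def lst_def z_def Od_def[symmetric] prod.case
    by (intro has_sum_cmult_right power_has_sum_lists XO)
  have inner_abs: "((\<lambda>\<alpha>. norm (g (k, \<alpha>))) has_sum (arcsin_coeff k * s ^ (2 * k + 1))) (lst k)" for k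
  proof -
    have "((\<lambda>\<alpha>. arcsin_coeff k * (\<Prod>j<2 * k + 1. \<bar>X (\<alpha> ! j)\<bar>)) has_sum (arcsin_coeff k * s ^ (2 * k + 1))) (lst k)"
      unfolding lst_def s_def using summable
      by (intro has_sum_cmult_right power_has_sum_lists) (simp add: Od_def)
    moreover have "norm (g (k, \<alpha>)) = arcsin_coeff k * (\<Prod>j<2 * k + 1. \<bar>X (\<alpha> ! j)\<bar>)" for \<alpha>
      using arcsin_coeff_pos[of k] by (simp add: g_def abs_mult abs_prod)
    ultimately show ?thesis by simp
  qed
  have "(\<lambda>p. norm (g p)) summable_on T"
    unfolding T_def Infinite_Sum.abs_summable_on_Sigma_iff
  proof (intro conjI ballI)
    show "(\<lambda>\<alpha>. norm (g (k, \<alpha>))) summable_on lst k" for k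
      using inner_abs has_sum_imp_summable by blast
    have inf: "infsum (\<lambda>\<alpha>. norm (g (k, \<alpha>))) (lst k) = arcsin_coeff k * s ^ (2 * k + 1)" for k
      using inner_abs by (rule infsumI)
    have "norm (arcsin_coeff k * s ^ (2 * k + 1)) = arcsin_coeff k * s ^ (2 * k + 1)" for k
      using s0 arcsin_coeff_pos[of k] by simp
    then show "(\<lambda>k. norm (infsum (\<lambda>\<alpha>. norm (g (k, \<alpha>))) (lst k))) summable_on {1..}"
      unfolding inf using has_sum_imp_summable[OF arcsin_series_tail[of s]] s0 s1 by simp
  qed
  then have gT: "g summable_on T" by (rule abs_summable_summable)
  have hasT: "(g has_sum (arcsin z - z)) T"
    unfolding T_def
  proof (rule has_sum_SigmaI)
    show "((\<lambda>k. arcsin_coeff k * z ^ (2 * k + 1)) has_sum (arcsin z - z)) {1..}"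
      using z1 by (rule arcsin_series_tail)
  qed (use inner gT T_def in auto)
  \<comment> \<open>\<open>D N\<close> collects the pairs \<open>(k, \<alpha>)\<close> of total degree \<open>N\<close>; it is finite.\<close>
  define D where "D N = Sigma {1..N div 2} (\<lambda>k. odd_tuples (2 * k + 1) N)" for N
  have bij: "bij_betw snd (Sigma UNIV D) T"
  proof (rule bij_betwI[where g = "\<lambda>p. (sum_list (snd p), p)"])
    show "snd \<in> Sigma UNIV D \<rightarrow> T"
      by (auto simp: D_def T_def lst_def Od_def odd_tuples_def)
    show "(\<lambda>p. (sum_list (snd p), p)) \<in> T \<rightarrow> Sigma UNIV D"
    proof
      fix p assume "p \<in> T"
      then obtain k \<alpha> where p: "p = (k, \<alpha>)" "1 \<le> k" "\<alpha> \<in> odd_tuples (2 * k + 1) (sum_list \<alpha>)"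
        unfolding T_def lst_def Od_def odd_tuples_def by blast
      have "2 * k + 1 \<le> sum_list \<alpha>"
        using p(3) odd_tuples_eq_empty[of "sum_list \<alpha>" "2 * k + 1"] by force
      then show "(sum_list (snd p), p) \<in> Sigma UNIV D"
        using p by (auto simp: D_def)
    qed
  qed (auto simp: D_def odd_tuples_def)
  have "((\<lambda>p. g (snd p)) has_sum (arcsin z - z)) (Sigma UNIV D)"
    using has_sum_reindex_bij_betw[OF bij, of g] hasT by simp
  then have "((\<lambda>N. \<Sum>p\<in>D N. g p) has_sum (arcsin z - z)) UNIV"
    by (rule has_sum_SigmaD)
      (auto simp: D_def finite_odd_tuples intro!: has_sum_finiteI)
  then show ?thesis
    by (simp add: arcsin_part_eq_sum_Sigma[abs_def] g_def D_def)
qed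

text \<open>
  The partial sums of the majorant series stay below every supersolution \<open>s\<close> of the scalar
  equation \<open>y = u + K (arcsin y - y)\<close>.
\<close>

lemma majorant_partial_sum_le:
  fixes K u s :: real
  assumes K: "0 \<le> K" and u: "0 \<le> u" and s: "0 \<le> s" "s < 1"
    and super: "u + K * (arcsin s - s) \<le> s"
  shows "(\<Sum>N\<le>n. majorant K N * u ^ N) \<le> s"
proof (induction n)
  case 0
  then show ?case using s by (subst majorant_rec) (simp add: arcsin_part_even)
next
  case (Suc n)
  define x where "x N = majorant K N * u ^ N" for N
  define S where "S = (\<Sum>N\<le>n. x N)"
  have x0: "0 \<le> x N" for N unfolding x_def using majorant_nonneg[OF K] u by simp
  have S: "0 \<le> S" "S \<le> s" using Suc.IH x0 by (auto simp: S_def x_def intro: sum_nonneg)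
  define h where "h k = arcsin_coeff k * s ^ (2 * k + 1)" for k
  have part: "arcsin_part (majorant K) N * u ^ N = arcsin_part x N" for N
  proof -
    have "(\<Prod>j<2 * k + 1. majorant K (\<alpha> ! j)) * u ^ N = (\<Prod>j<2 * k + 1. x (\<alpha> ! j))"
      if "\<alpha> \<in> odd_tuples (2 * k + 1) N" for \<alpha> k
      using odd_tuples_sum_nth[OF that]
      by (simp add: x_def prod.distrib power_sum[symmetric] del: prod.lessThan_Suc)
    then show ?thesis
      unfolding arcsin_part_def sum_distrib_right
      by (intro sum.cong) (auto simp: sum_distrib_right mult.assoc simp del: prod.lessThan_Suc)
  qed
  have xN: "x N = (if N = 1 then u else 0) + K * arcsin_part x N" for N
    unfolding part[symmetric] unfolding x_def by (subst majorant_rec) (simp add: algebra_simps)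
  have "(\<Sum>N\<le>Suc n. arcsin_part x N) \<le> (\<Sum>k\<in>{1..Suc n}. h k)"
  proof -
    define g where "g = (\<lambda>(k, \<alpha>). arcsin_coeff k * (\<Prod>j<2 * k + 1. x (\<alpha> ! j)))"
    define D where "D N = Sigma {1..N div 2} (\<lambda>k. odd_tuples (2 * k + 1) N)" for N
    define lst where "lst k = {\<alpha>. set \<alpha> \<subseteq> {..n} \<and> length \<alpha> = 2 * k + 1}" for k
    have g0: "0 \<le> g p" for p
      unfolding g_def using x0 arcsin_coeff_pos less_imp_le
      by (auto simp: split_beta intro!: mult_nonneg_nonneg prod_nonneg)
    have "(\<Sum>N\<le>Suc n. arcsin_part x N) = (\<Sum>N\<le>Suc n. \<Sum>p\<in>D N. g p)"
      by (simp add: arcsin_part_eq_sum_Sigma g_def D_def)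
    also have "\<dots> = (\<Sum>p\<in>(\<Union>N\<le>Suc n. D N). g p)"
    proof (rule sum.UNION_disjoint[symmetric])
      show "\<forall>N\<in>{..Suc n}. finite (D N)" by (simp add: D_def finite_odd_tuples)
      show "\<forall>N\<in>{..Suc n}. \<forall>N'\<in>{..Suc n}. N \<noteq> N' \<longrightarrow> D N \<inter> D N' = {}"
        by (auto simp: D_def odd_tuples_def)
    qed simp
    also have "\<dots> \<le> (\<Sum>p\<in>Sigma {1..Suc n} lst. g p)"
    proof (rule sum_mono2)
      show "finite (Sigma {1..Suc n} lst)"
        by (auto simp: lst_def intro!: finite_lists_length_eq)
      show "(\<Union>N\<le>Suc n. D N) \<subseteq> Sigma {1..Suc n} lst"
      proof safe
        fix N k \<alpha> assume "N \<le> Suc n" "(k, \<alpha>) \<in> D N"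
        then have *: "N \<le> Suc n" "1 \<le> k" "k \<le> N div 2" "\<alpha> \<in> odd_tuples (2 * k + 1) N"
          by (auto simp: D_def)
        \<comment> \<open>a tuple of at least three positive entries has entries below its sum, so only the partial
            sum up to \<open>n\<close> enters\<close>
        have "\<alpha> ! j < N" if "j < length \<alpha>" for j
          using odd_tuples_nth_less[OF *(4) *(2)] that *(4) by (simp add: odd_tuples_def)
        then have "set \<alpha> \<subseteq> {..n}"
          using *(1) by (fastforce simp: in_set_conv_nth)
        then show "\<alpha> \<in> lst k" using *(4) by (simp add: lst_def odd_tuples_def)
        show "k \<in> {1..Suc n}" using * by auto
      qed
    qed (rule g0)
    also have "\<dots> = (\<Sum>k\<in>{1..Suc n}. \<Sum>\<alpha>\<in>lst k. g (k, \<alpha>))"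
      by (subst sum.Sigma) (auto simp: lst_def finite_lists_length_eq)
    also have "\<dots> = (\<Sum>k\<in>{1..Suc n}. arcsin_coeff k * S ^ (2 * k + 1))"
    proof (rule sum.cong)
      fix k
      have "((\<lambda>\<alpha>. \<Prod>j<2 * k + 1. x (\<alpha> ! j)) has_sum S ^ (2 * k + 1)) (lst k)"
        using power_has_sum_lists[of x "{..n}" "2 * k + 1"] by (simp add: S_def lst_def)
      moreover have "finite (lst k)" by (simp add: lst_def finite_lists_length_eq)
      ultimately have "(\<Sum>\<alpha>\<in>lst k. \<Prod>j<2 * k + 1. x (\<alpha> ! j)) = S ^ (2 * k + 1)"
        by (simp only: has_sum_finite_iff)
      then show "(\<Sum>\<alpha>\<in>lst k. g (k, \<alpha>)) = arcsin_coeff k * S ^ (2 * k + 1)"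
        by (simp add: g_def sum_distrib_left[symmetric])
    qed simp
    also have "\<dots> \<le> (\<Sum>k\<in>{1..Suc n}. h k)"
      unfolding h_def using S arcsin_coeff_pos
      by (intro sum_mono mult_left_mono power_mono) (auto simp: less_imp_le)
    finally show ?thesis .
  qed
  also have "\<dots> \<le> arcsin s - s"
    using s arcsin_coeff_pos unfolding h_def
    by (intro finite_sum_le_has_sum[OF arcsin_series_tail]) (auto simp: less_imp_le)
  finally have le: "(\<Sum>N\<le>Suc n. arcsin_part x N) \<le> arcsin s - s" .
  have "(\<Sum>N\<le>Suc n. x N) = u + K * (\<Sum>N\<le>Suc n. arcsin_part x N)"
    by (subst xN) (simp add: sum.distrib sum_distrib_left del: sum.atMost_Suc)
  also have "\<dots> \<le> u + K * (arcsin s - s)" using le K by (intro add_left_mono mult_left_mono)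
  also have "\<dots> \<le> s" by (rule super)
  finally show ?case by (simp only: x_def)
qed

lemma has_sum_finite_sum:
  fixes f :: "'i \<Rightarrow> 'a \<Rightarrow> real"
  assumes "finite I" "\<And>i. i \<in> I \<Longrightarrow> (f i has_sum s i) A"
  shows "((\<lambda>x. \<Sum>i\<in>I. f i x) has_sum (\<Sum>i\<in>I. s i)) A"
  using assms by (induction I rule: finite_induct) (auto intro: has_sum_add)

lemma has_sum_diff_real:
  fixes f g :: "'a \<Rightarrow> real"
  assumes "(f has_sum a) A" "(g has_sum b) A"
  shows "((\<lambda>x. f x - g x) has_sum (a - b)) A"
  using has_sum_add[OF assms(1) has_sum_uminusI[OF assms(2)]] by simp

lemma has_sum_vec:
  fixes f :: "'a \<Rightarrow> real^'m::finite"
  assumes "\<And>e. ((\<lambda>x. f x $ e) has_sum (s $ e)) A"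
  shows "(f has_sum s) A"
  using assms unfolding has_sum_def by (intro vec_tendstoI) simp

text \<open>
  The series of homogeneous terms converges absolutely, also when each term is split into its
  monomials, and its sum solves the fixed-point equation.
\<close>

lemma A_term_series:
  fixes P :: "real^'m^'m::finite" and \<eta> :: "real^'m"
  assumes K: "\<And>e. (\<Sum>f\<in>UNIV. \<bar>P $ e $ f\<bar>) \<le> K"
    and u: "0 \<le> u" "\<And>e. \<bar>\<eta> $ e\<bar> \<le> u" and s: "0 \<le> s" "s < 1"
    and super: "u + K * (arcsin s - s) \<le> s"
  obtains c \<psi> where
    "\<And>N. homogeneous_polynomial N c (A_term P N)"
    "\<And>\<nu>. even (multi_degree \<nu>) \<Longrightarrow> c \<nu> = 0"
    "\<And>e. \<bar>\<psi> $ e\<bar> \<le> s"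
    "\<psi> = \<eta> - P *v ((\<chi> e. arcsin (\<psi> $ e)) - \<psi>)"
    "(\<lambda>i. A_term P (2 * i + 1) \<eta>) sums \<psi>"
    "strongly_converges_to c 0 \<eta> \<psi>"
proof -
  have K0: "0 \<le> K" using K[of undefined] by (meson abs_ge_zero order_trans sum_nonneg)
  obtain c where c: "\<And>N. homogeneous_polynomial N c (A_term P N)"
    "\<And>N e. (\<Sum>\<nu> | multi_degree \<nu> = N. \<bar>c \<nu> $ e\<bar>) \<le> majorant K N"
    "\<And>\<nu>. even (multi_degree \<nu>) \<Longrightarrow> c \<nu> = 0"
    using A_term_coefficients[OF K] by blast
  define x where "x N = majorant K N * u ^ N" for N
  have x0: "0 \<le> x N" for N unfolding x_def using majorant_nonneg[OF K0] u by simp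
  have x_le: "(\<Sum>N\<in>F. x N) \<le> s" if "finite F" for F
  proof -
    have "(\<Sum>N\<in>F. x N) \<le> (\<Sum>N\<le>Max (insert 0 F). x N)"
      using that x0 by (intro sum_mono2) auto
    also have "\<dots> \<le> s"
      unfolding x_def using majorant_partial_sum_le[OF K0 u(1) s super] .
    finally show ?thesis .
  qed
  have xs: "x summable_on UNIV"
    using x0 x_le by (intro nonneg_bdd_above_summable_on bdd_aboveI2[of _ _ s]) auto
  have x_inf: "infsum x UNIV \<le> s"
    using xs x_le by (intro infsum_le_finite_sums) auto
  define t where "t e \<nu> = multi_power \<eta> \<nu> * c \<nu> $ e" for e \<nu>
  have t_abs: "(\<Sum>\<nu> | multi_degree \<nu> = N. \<bar>t e \<nu>\<bar>) \<le> x N" for e N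
  proof -
    have "(\<Sum>\<nu> | multi_degree \<nu> = N. \<bar>t e \<nu>\<bar>) \<le> (\<Sum>\<nu> | multi_degree \<nu> = N. u ^ N * \<bar>c \<nu> $ e\<bar>)"
      unfolding t_def abs_mult using u by (intro sum_mono mult_right_mono multi_power_bound) auto
    also have "\<dots> \<le> u ^ N * majorant K N"
      using u c(2)[of e N] by (simp add: sum_distrib_left[symmetric] mult_left_mono)
    finally show ?thesis by (simp add: x_def mult.commute)
  qed
  have At: "A_term P N \<eta> $ e = (\<Sum>\<nu> | multi_degree \<nu> = N. t e \<nu>)" for N e
    using c(1)[of N] by (simp add: homogeneous_polynomial_def t_def)
  have A_abs: "\<bar>A_term P N \<eta> $ e\<bar> \<le> x N" for N e
    unfolding At using sum_abs t_abs by (rule order_trans)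
  have A_even: "A_term P N \<eta> = 0" if "even N" for N
    using that by (subst A_term.simps) simp
  have A_summable: "(\<lambda>N. \<bar>A_term P N \<eta> $ e\<bar>) summable_on UNIV" for e
    using A_abs by (intro summable_on_comparison_test[OF xs]) auto
  define \<psi> where "\<psi> = (\<chi> e. \<Sum>\<^sub>\<infinity>N. A_term P N \<eta> $ e)"
  have A_sum: "((\<lambda>N. A_term P N \<eta> $ e) has_sum \<psi> $ e) UNIV" for e
    unfolding \<psi>_def vec_lambda_beta using A_summable[of e]
    by (intro has_sum_infsum) (subst summable_on_iff_abs_summable_on_real, simp)
  have A_inf_abs: "(\<Sum>\<^sub>\<infinity>N. \<bar>A_term P N \<eta> $ e\<bar>) \<le> s" for e
    using infsum_mono[OF A_summable xs A_abs] x_inf by (rule order_trans)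
  have A_odd: "infsum (\<lambda>N. f (A_term P N \<eta> $ e)) {N. odd N} = infsum (\<lambda>N. f (A_term P N \<eta> $ e)) UNIV"
    if "f 0 = 0" for f :: "real \<Rightarrow> real" and e
    using that by (intro infsum_cong_neutral) (auto simp: A_even)
  have \<psi>_le: "\<bar>\<psi> $ e\<bar> \<le> s" for e
    using norm_infsum_bound[of "\<lambda>N. A_term P N \<eta> $ e" UNIV] A_summable[of e] A_inf_abs[of e]
    by (simp add: \<psi>_def)
  have part: "(arcsin_part (\<lambda>N. A_term P N \<eta> $ f) has_sum (arcsin (\<psi> $ f) - \<psi> $ f)) UNIV" for f
  proof -
    have "(\<lambda>N. \<bar>A_term P N \<eta> $ f\<bar>) summable_on {N. odd N}"
      using A_summable[of f] by (rule summable_on_subset_banach) simp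
    moreover have "(\<Sum>\<^sub>\<infinity>N | odd N. \<bar>A_term P N \<eta> $ f\<bar>) < 1"
      using A_odd[of abs f] A_inf_abs[of f] s by simp
    ultimately show ?thesis
      using arcsin_part_has_sum[of "\<lambda>N. A_term P N \<eta> $ f"] A_odd[of "\<lambda>x. x" f] by (simp add: \<psi>_def)
  qed
  have comp: "\<psi> $ e = \<eta> $ e - (\<Sum>f\<in>UNIV. P $ e $ f * (arcsin (\<psi> $ f) - \<psi> $ f))" for e
  proof (rule has_sum_unique[OF A_sum])
    have "((\<lambda>N. if N = 1 then \<eta> $ e else 0) has_sum \<eta> $ e) UNIV"
      by (rule has_sum_finite_neutralI[of "{1}"]) auto
    moreover have "((\<lambda>N. \<Sum>f\<in>UNIV. P $ e $ f * arcsin_part (\<lambda>N. A_term P N \<eta> $ f) N) has_sum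
        (\<Sum>f\<in>UNIV. P $ e $ f * (arcsin (\<psi> $ f) - \<psi> $ f))) UNIV"
      by (intro has_sum_finite_sum has_sum_cmult_right part) simp
    ultimately have "((\<lambda>N. (if N = 1 then \<eta> $ e else 0) -
          (\<Sum>f\<in>UNIV. P $ e $ f * arcsin_part (\<lambda>N. A_term P N \<eta> $ f) N)) has_sum
        (\<eta> $ e - (\<Sum>f\<in>UNIV. P $ e $ f * (arcsin (\<psi> $ f) - \<psi> $ f)))) UNIV"
      by (rule has_sum_diff_real)
    then show "((\<lambda>N. A_term P N \<eta> $ e) has_sum
        (\<eta> $ e - (\<Sum>f\<in>UNIV. P $ e $ f * (arcsin (\<psi> $ f) - \<psi> $ f)))) UNIV"
      by (rule has_sum_cong[THEN iffD1, rotated]) (rule A_term_component[symmetric])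
  qed
  have "(\<eta> - P *v ((\<chi> e. arcsin (\<psi> $ e)) - \<psi>)) $ e
      = \<eta> $ e - (\<Sum>f\<in>UNIV. P $ e $ f * (arcsin (\<psi> $ f) - \<psi> $ f))" for e
    by (simp add: matrix_vector_mult_def)
  then have "\<psi> $ e = (\<eta> - P *v ((\<chi> e. arcsin (\<psi> $ e)) - \<psi>)) $ e" for e
    by (rule trans[OF comp sym])
  then have fixed: "\<psi> = \<eta> - P *v ((\<chi> e. arcsin (\<psi> $ e)) - \<psi>)"
    unfolding vec_eq_iff by blast
  have "((\<lambda>N. A_term P N \<eta>) has_sum \<psi>) UNIV"
    by (intro has_sum_vec A_sum)
  then have "(\<lambda>N. A_term P N \<eta>) sums \<psi>"
    by (rule has_sum_imp_sums)
  moreover have "A_term P N \<eta> = 0" if "N \<notin> range (\<lambda>i. 2 * i + 1)" for N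
    using that by (cases "even N") (auto intro: A_even elim!: oddE)
  ultimately have sums: "(\<lambda>i. A_term P (2 * i + 1) \<eta>) sums \<psi>"
    using sums_mono_reindex[of "\<lambda>i. 2 * i + 1" "\<lambda>N. A_term P N \<eta>" \<psi>] by (simp add: strict_mono_def)
  have t_sum: "(t e has_sum \<psi> $ e) UNIV" for e
  proof -
    have bij: "bij_betw snd (SIGMA N:UNIV. {\<nu> :: nat^'m. multi_degree \<nu> = N}) UNIV"
      by (rule bij_betwI[where g = "\<lambda>\<nu>. (multi_degree \<nu>, \<nu>)"]) auto
    have "((\<lambda>p. t e (snd p)) has_sum \<psi> $ e) (SIGMA N:UNIV. {\<nu> :: nat^'m. multi_degree \<nu> = N})"
    proof (rule has_sum_SigmaI)
      show "((\<lambda>\<nu>. t e (snd (N, \<nu>))) has_sum A_term P N \<eta> $ e) {\<nu>. multi_degree \<nu> = N}" for N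
        by (auto intro!: has_sum_finiteI simp: At finite_multi_degree)
      show "(\<lambda>p. t e (snd p)) summable_on (SIGMA N:UNIV. {\<nu> :: nat^'m. multi_degree \<nu> = N})"
      proof (rule abs_summable_summable, unfold Infinite_Sum.abs_summable_on_Sigma_iff, intro conjI ballI)
        show "(\<lambda>\<nu>. norm (t e (snd (N, \<nu>)))) summable_on {\<nu>. multi_degree \<nu> = N}" for N
          by (simp add: finite_multi_degree)
        have inf: "(\<Sum>\<^sub>\<infinity>\<nu>\<in>{\<nu>. multi_degree \<nu> = N}. norm (t e (snd (N, \<nu>))))
            = (\<Sum>\<nu> | multi_degree \<nu> = N. \<bar>t e \<nu>\<bar>)" for N
          by (simp add: finite_multi_degree)
        show "(\<lambda>N. norm (\<Sum>\<^sub>\<infinity>\<nu>\<in>{\<nu>. multi_degree \<nu> = N}. norm (t e (snd (N, \<nu>))))) summable_on UNIV"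
          unfolding inf
          using t_abs by (intro Infinite_Sum.abs_summable_on_comparison_test'[OF xs]) (simp add: sum_nonneg)
      qed
    qed (rule A_sum)
    then show ?thesis using has_sum_reindex_bij_betw[OF bij, of "t e"] by simp
  qed
  have "strongly_converges_to c 0 \<eta> \<psi>"
    unfolding strongly_converges_to_def
  proof (intro allI impI)
    fix \<pi> :: "nat \<Rightarrow> nat^'m" assume "bij \<pi>"
    moreover have "((\<lambda>\<nu>. multi_power (\<eta> - 0) \<nu> *\<^sub>R c \<nu>) has_sum \<psi>) UNIV"
      using t_sum[unfolded t_def[abs_def]] by (intro has_sum_vec) simp
    ultimately have "((\<lambda>k. multi_power (\<eta> - 0) (\<pi> k) *\<^sub>R c (\<pi> k)) has_sum \<psi>) UNIV"
      using has_sum_reindex_bij_betw[of \<pi> UNIV UNIV "\<lambda>\<nu>. multi_power (\<eta> - 0) \<nu> *\<^sub>R c \<nu>"] by simp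
    then show "(\<lambda>k. multi_power (\<eta> - 0) (\<pi> k) *\<^sub>R c (\<pi> k)) sums \<psi>"
      by (rule has_sum_imp_sums)
  qed
  with c(1,3) \<psi>_le fixed sums that show thesis by blast
qed

text \<open>
  The norm induced by \<open>infnorm\<close> dominates each absolute row sum, as the vector of signs of that row
  shows.
\<close>

lemma row_sum_le_matrix_infnorm:
  fixes P :: "real^'k::finite^'l::finite"
  shows "(\<Sum>f\<in>UNIV. \<bar>P $ e $ f\<bar>) \<le> matrix_infnorm P"
proof -
  define C where "C = (\<Sum>e\<in>UNIV. \<Sum>f\<in>UNIV. \<bar>P $ e $ f\<bar>)"
  have row: "(\<Sum>f\<in>UNIV. \<bar>P $ e $ f\<bar>) \<le> C" for e
    unfolding C_def by (rule member_le_sum) (auto intro: sum_nonneg)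
  have "infnorm (P *v v) / infnorm v \<le> C" for v
  proof (cases "v = 0")
    case True
    then show ?thesis by (simp add: C_def sum_nonneg infnorm_0)
  next
    case False
    have "\<bar>(P *v v) $ e\<bar> \<le> C * infnorm v" for e
    proof -
      have "\<bar>(P *v v) $ e\<bar> \<le> (\<Sum>f\<in>UNIV. \<bar>P $ e $ f\<bar> * \<bar>v $ f\<bar>)"
        unfolding matrix_vector_mult_def by (auto simp: abs_mult intro: order_trans[OF sum_abs])
      also have "\<dots> \<le> (\<Sum>f\<in>UNIV. \<bar>P $ e $ f\<bar> * infnorm v)"
        by (intro sum_mono mult_left_mono component_le_infnorm_cart) auto
      also have "\<dots> \<le> C * infnorm v"
        using row[of e] by (simp add: sum_distrib_right[symmetric] mult_right_mono infnorm_pos_le)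
      finally show ?thesis .
    qed
    then have "infnorm (P *v v) \<le> C * infnorm v"
      unfolding infnorm_cart[of "P *v v"] by (intro cSup_least) auto
    then show ?thesis using False by (simp add: divide_le_eq infnorm_pos_lt)
  qed
  then have bdd: "bdd_above (range (\<lambda>v. infnorm (P *v v) / infnorm v))"
    by (intro bdd_aboveI2)
  define v :: "real^'k" where "v = (\<chi> f. if 0 \<le> P $ e $ f then 1 else - 1)"
  have "infnorm v = 1"
  proof -
    have "{\<bar>v $ i\<bar> |i. i \<in> UNIV} = {1}" by (auto simp: v_def)
    then show ?thesis by (simp add: infnorm_cart)
  qed
  moreover have "(\<Sum>f\<in>UNIV. \<bar>P $ e $ f\<bar>) = (P *v v) $ e"
    unfolding matrix_vector_mult_def by (auto simp: v_def intro!: sum.cong)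
  then have "(\<Sum>f\<in>UNIV. \<bar>P $ e $ f\<bar>) \<le> infnorm (P *v v)"
    using component_le_infnorm_cart[of "P *v v" e] by simp
  ultimately have "(\<Sum>f\<in>UNIV. \<bar>P $ e $ f\<bar>) \<le> infnorm (P *v v) / infnorm v" by simp
  also have "\<dots> \<le> matrix_infnorm P"
    unfolding matrix_infnorm_def by (rule cSUP_upper[OF _ bdd]) simp
  finally show ?thesis .
qed

section \<open>The weighted graph: pseudoinverse of the Laplacian and uniqueness of equilibria\<close>

lemma infnorm_le_iff_cart:
  fixes v :: "real^'m::finite"
  shows "infnorm v \<le> c \<longleftrightarrow> (\<forall>e. \<bar>v $ e\<bar> \<le> c)"
proof
  show "\<forall>e. \<bar>v $ e\<bar> \<le> c" if "infnorm v \<le> c"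
    using that component_le_infnorm_cart order_trans by blast
  show "infnorm v \<le> c" if "\<forall>e. \<bar>v $ e\<bar> \<le> c"
    unfolding infnorm_cart using that by (intro cSup_least) auto
qed

lemma is_pseudoinverse_unique:
  assumes X: "is_pseudoinverse M X" and Y: "is_pseudoinverse M Y"
  shows "X = Y"
proof -
  have sym: "transpose (M ** X) = M ** X" "transpose (X ** M) = X ** M"
      "transpose (M ** Y) = M ** Y" "transpose (Y ** M) = Y ** M"
    and inner: "M ** X ** M = M" "M ** Y ** M = M"
    using X Y by (auto simp: is_pseudoinverse_def)
  have "M ** X = (M ** Y) ** (M ** X)" using inner(2) by (simp add: matrix_mul_assoc)
  then have "transpose (M ** X) = transpose (M ** X) ** transpose (M ** Y)"
    by (simp add: matrix_transpose_mul[symmetric])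
  also have "\<dots> = M ** Y" using inner(1) by (simp add: sym matrix_mul_assoc)
  finally have MX: "M ** X = M ** Y" by (simp add: sym)
  have "X ** M = (X ** M) ** (Y ** M)" using inner(2) by (simp add: matrix_mul_assoc[symmetric])
  then have "transpose (X ** M) = transpose (Y ** M) ** transpose (X ** M)"
    by (simp add: matrix_transpose_mul[symmetric])
  also have "\<dots> = Y ** M" using inner(1) by (simp add: sym matrix_mul_assoc[symmetric])
  finally have XM: "X ** M = Y ** M" by (simp add: sym)
  have "X = X ** M ** X" using X by (simp add: is_pseudoinverse_def)
  also have "\<dots> = Y ** (M ** X)" by (simp add: XM matrix_mul_assoc)
  also have "\<dots> = Y" using Y by (simp add: MX is_pseudoinverse_def matrix_mul_assoc)
  finally show ?thesis .
qed

lemma pseudoinverse_eqI: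
  assumes "is_pseudoinverse M X"
  shows "pseudoinverse M = X"
  unfolding pseudoinverse_def using assms is_pseudoinverse_unique by (intro the_equality) blast+

text \<open>The orthogonal projection onto the span of the all-ones vector.\<close>

definition averaging :: "real^'n^'n::finite" where
  "averaging = (\<chi> i j. 1 / real CARD('n))"

lemma averaging_mult: "averaging *v x = ((1 \<bullet> x) / real CARD('n)) *\<^sub>R (1 :: real^'n::finite)"
  by (simp add: averaging_def matrix_vector_mult_def vec_eq_iff inner_vec_def sum_divide_distrib)

lemma inner_one_one: "(1 :: real^'n::finite) \<bullet> 1 = real CARD('n)"
  by (simp add: inner_vec_def)

lemma averaging_idem: "averaging ** averaging = (averaging :: real^'n^'n::finite)"
  by (simp add: averaging_def matrix_matrix_mult_def vec_eq_iff)

lemma transpose_averaging: "transpose averaging = averaging"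
  by (simp add: averaging_def transpose_def vec_eq_iff)

lemma matrix_mult_diff_left:
  fixes A A' :: "real^'b^'a" and B :: "real^'c^'b"
  shows "(A - A') ** B = A ** B - A' ** B"
  by (simp add: matrix_matrix_mult_def vec_eq_iff algebra_simps sum_subtractf)

lemma matrix_mult_diff_right:
  fixes A :: "real^'b^'a" and B B' :: "real^'c^'b"
  shows "A ** (B - B') = A ** B - A ** B'"
  by (simp add: matrix_matrix_mult_def vec_eq_iff algebra_simps sum_subtractf)

lemma matrix_add_rdistrib:
  fixes A A' :: "real^'b^'a" and B :: "real^'c^'b"
  shows "(A + A') ** B = A ** B + A' ** B"
  by (simp add: matrix_matrix_mult_def vec_eq_iff algebra_simps sum.distrib)

lemma transpose_diff: "transpose (A - A') = transpose A - transpose (A' :: real^'b^'a)"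
  by (simp add: transpose_def vec_eq_iff)

lemma matrix_inv_props:
  assumes "invertible (M :: real^'n^'n::finite)"
  shows "M ** matrix_inv M = mat 1" "matrix_inv M ** M = mat 1"
  using assms unfolding invertible_def matrix_inv_def by (metis (mono_tags, lifting) someI_ex)+

text \<open>
  Strong monotonicity of the sine away from \<open>\<plusminus> \<pi>/2\<close>; uniqueness and stability of cohesive equilibria
  both rest on it.
\<close>

lemma sin_diff_coercive:
  fixes s t :: real
  assumes "\<bar>s\<bar> \<le> \<beta>" "\<bar>t\<bar> \<le> \<beta>" "\<beta> \<le> pi / 2"
  shows "cos \<beta> * (s - t)\<^sup>2 \<le> (s - t) * (sin s - sin t)"
proof -
  have le: "cos \<beta> * (s - t)\<^sup>2 \<le> (s - t) * (sin s - sin t)"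
    if "t < s" "\<bar>s\<bar> \<le> \<beta>" "\<bar>t\<bar> \<le> \<beta>" for s t :: real
  proof -
    obtain z where z: "t < z" "z < s" "sin s - sin t = (s - t) * cos z"
      using MVT2[of t s sin cos] \<open>t < s\<close> by (auto intro: DERIV_sin)
    have "cos \<beta> \<le> cos \<bar>z\<bar>"
      using z that assms(3) by (intro cos_monotone_0_pi_le) auto
    then have "cos \<beta> * (s - t)\<^sup>2 \<le> cos z * (s - t)\<^sup>2"
      by (intro mult_right_mono) auto
    then show ?thesis using z(3) by (simp add: power2_eq_square mult.commute mult.left_commute)
  qed
  show ?thesis
  proof (cases s t rule: linorder_cases)
    case less
    have "cos \<beta> * (t - s)\<^sup>2 \<le> (t - s) * (sin t - sin s)" using le[OF less] assms by simp
    then show ?thesis by (simp add: power2_eq_square algebra_simps)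
  qed (use le assms in auto)
qed

text \<open>
  A connected weighted graph with a chosen orientation of its edges, its incidence matrix \<open>B\<close> and its
  diagonal weight matrix \<open>W\<close>.
\<close>

locale kuramoto_network =
  fixes E :: "('n::finite \<times> 'n) set" and a :: "real^'n^'n"
    and d :: "'m::finite \<Rightarrow> 'n \<times> 'n"
    and B :: "real^'m^'n" and W :: "real^'m^'m"
  assumes graph: "weighted_graph E a" "graph_connected E" "edge_orientation E d"
    and B: "B = incidence_matrix d"
    and W: "W = weight_matrix d a"
begin

text \<open>The weight of an edge, that is, the diagonal entry of \<open>W\<close>.\<close>

definition weight :: "'m \<Rightarrow> real" where
  "weight e = a $ fst (d e) $ snd (d e)"

lemma edge_in_E: "d e \<in> E"
  using graph(3) by (auto simp: edge_orientation_def)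

lemma weight_pos: "0 < weight e"
  using graph(1) edge_in_E[of e] by (auto simp: weighted_graph_def weight_def split_beta)

lemma tail_neq_head: "fst (d e) \<noteq> snd (d e)"
  using graph(1) edge_in_E[of e] by (metis weighted_graph_def irrefl_def prod.collapse)

lemma edge_difference: "(transpose B *v x) $ e = x $ fst (d e) - x $ snd (d e)"
proof -
  have "(transpose B *v x) $ e = (\<Sum>i\<in>UNIV. B $ i $ e * x $ i)"
    by (simp add: matrix_vector_mult_def transpose_def del: transpose_matrix_vector)
  also have "\<dots> = (\<Sum>i\<in>UNIV. (if i = fst (d e) then x $ i else 0) - (if i = snd (d e) then x $ i else 0))"
    unfolding B incidence_matrix_def using tail_neq_head[of e] by (intro sum.cong) auto
  also have "\<dots> = x $ fst (d e) - x $ snd (d e)"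
    by (simp add: sum_subtractf)
  finally show ?thesis .
qed

lemma edge_difference_add: "transpose B *v (x + y) = transpose B *v x + transpose B *v y"
  by (simp add: matrix_vector_right_distrib del: transpose_matrix_vector)

lemma weight_mult: "(W *v v) $ e = weight e * v $ e"
proof -
  have "(W *v v) $ e = (\<Sum>f\<in>UNIV. if f = e then weight e * v $ f else 0)"
    unfolding W weight_matrix_def weight_def matrix_vector_mult_def
    by (simp add: if_distrib[of "\<lambda>x. x * _"] cong: if_cong)
  then show ?thesis by simp
qed

lemma inner_B: "x \<bullet> (B *v y) = (transpose B *v x) \<bullet> y"
  by (simp add: dot_lmul_matrix)

lemma inner_BW: "x \<bullet> ((B ** W) *v y) = (\<Sum>e\<in>UNIV. weight e * (transpose B *v x) $ e * y $ e)"
proof -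
  have "x \<bullet> ((B ** W) *v y) = (transpose B *v x) \<bullet> (W *v y)"
    by (simp only: matrix_vector_mul_assoc[symmetric] inner_B)
  then show ?thesis
    by (simp add: inner_vec_def weight_mult algebra_simps del: transpose_matrix_vector)
qed

lemma edge_difference_one: "transpose B *v (c *\<^sub>R 1) = 0"
  by (simp add: vec_eq_iff edge_difference del: transpose_matrix_vector)

lemma edge_difference_eq_0_imp_const:
  assumes "transpose B *v x = 0"
  shows "x $ i = x $ j"
proof -
  have adj: "x $ i = x $ j" if ij: "(i, j) \<in> E" for i j
  proof -
    obtain e where "d e = (i, j) \<or> d e = (j, i)"
      using graph(3) ij unfolding edge_orientation_def by blast
    moreover have "x $ fst (d e) - x $ snd (d e) = 0"
      using assms edge_difference[of x e] by simp
    ultimately show ?thesis by auto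
  qed
  have "(i, j) \<in> E\<^sup>*" using graph(2) by (simp add: graph_connected_def)
  then show ?thesis by (induction rule: rtrancl_induct) (auto dest: adj)
qed

lemma edge_difference_eq_0_imp_0:
  assumes "transpose B *v x = 0" "1 \<bullet> x = 0"
  shows "x = 0"
proof -
  have "x = (x $ undefined) *\<^sub>R 1"
    using edge_difference_eq_0_imp_const[OF assms(1)] by (simp add: vec_eq_iff)
  then have "(x $ undefined) * real CARD('n) = 0"
    using assms(2) by (metis inner_one_one inner_scaleR_right)
  then have "x $ undefined = 0" by simp
  then show ?thesis
    using edge_difference_eq_0_imp_const[OF assms(1)] by (metis vec_eq_iff zero_index)
qed

abbreviation L :: "real^'n^'n" where "L \<equiv> laplacian B W"
abbreviation Lp :: "real^'n^'n" where "Lp \<equiv> pseudoinverse (laplacian B W)"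

lemma laplacian_mult: "L *v z = (B ** W) *v (transpose B *v z)"
  by (simp add: laplacian_def matrix_vector_mul_assoc del: transpose_matrix_vector)

lemma inner_laplacian: "x \<bullet> (L *v y) = (\<Sum>e\<in>UNIV. weight e * (transpose B *v x) $ e * (transpose B *v y) $ e)"
  by (simp only: laplacian_mult inner_BW)

lemma transpose_laplacian: "transpose L = L"
proof -
  have W': "transpose W = W"
    by (simp add: W weight_matrix_def transpose_def vec_eq_iff)
  show ?thesis
    by (simp add: laplacian_def matrix_transpose_mul W' matrix_mul_assoc)
qed

lemma averaging_incidence: "averaging ** B = 0"
proof -
  have "averaging *v (B *v y) = 0" for y
  proof -
    have "1 \<bullet> (B *v y) = 0"
      using edge_difference_one[of 1] by (simp only: inner_B scaleR_one inner_zero_left)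
    then show ?thesis by (simp add: averaging_mult)
  qed
  then show ?thesis
    by (simp add: matrix_eq matrix_vector_mul_assoc)
qed

lemma averaging_laplacian: "averaging ** L = 0" "L ** averaging = 0"
proof -
  show *: "averaging ** L = 0"
    by (simp add: laplacian_def matrix_mul_assoc averaging_incidence)
  have "transpose (averaging ** L) = 0" unfolding * by (simp add: transpose_def vec_eq_iff)
  then show "L ** averaging = 0"
    by (simp add: matrix_transpose_mul transpose_averaging transpose_laplacian)
qed

lemma invertible_laplacian_averaging: "invertible (L + averaging)"
proof -
  have "x = 0" if "(L + averaging) *v x = 0" for x
  proof -
    have "0 = x \<bullet> ((L + averaging) *v x)" using that by simp
    also have "\<dots> = (\<Sum>e\<in>UNIV. weight e * ((transpose B *v x) $ e)\<^sup>2) + (1 \<bullet> x)\<^sup>2 / real CARD('n)"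
      by (simp add: matrix_vector_mult_add_rdistrib inner_add_right inner_laplacian averaging_mult
          power2_eq_square mult.assoc inner_commute del: transpose_matrix_vector)
    finally have *: "(\<Sum>e\<in>UNIV. weight e * ((transpose B *v x) $ e)\<^sup>2) + (1 \<bullet> x)\<^sup>2 / real CARD('n) = 0" ..
    have nn: "0 \<le> weight e * ((transpose B *v x) $ e)\<^sup>2" for e
      using weight_pos[of e] by simp
    have "0 \<le> (\<Sum>e\<in>UNIV. weight e * ((transpose B *v x) $ e)\<^sup>2)" "0 \<le> (1 \<bullet> x)\<^sup>2 / real CARD('n)"
      by (intro sum_nonneg nn) simp
    with * have sum0: "(\<Sum>e\<in>UNIV. weight e * ((transpose B *v x) $ e)\<^sup>2) = 0"
      and sq0: "(1 \<bullet> x)\<^sup>2 / real CARD('n) = 0"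
      by linarith+
    have "(transpose B *v x) $ e = 0" for e
    proof -
      have "weight e * ((transpose B *v x) $ e)\<^sup>2 = 0"
        using sum0 nn by (subst (asm) sum_nonneg_eq_0_iff) auto
      then show ?thesis using weight_pos[of e] by (simp del: transpose_matrix_vector)
    qed
    then have "transpose B *v x = 0" by (simp add: vec_eq_iff del: transpose_matrix_vector)
    moreover have "1 \<bullet> x = 0" using sq0 by simp
    ultimately show ?thesis by (rule edge_difference_eq_0_imp_0)
  qed
  then show ?thesis
    by (simp add: invertible_left_inverse matrix_left_invertible_ker)
qed

text \<open>
  Since \<open>L + averaging\<close> is invertible and fixes the all-ones vector, the pseudoinverse of \<open>L\<close> is
  obtained from its inverse by removing the averaging part.
\<close>

lemma laplacian_pseudoinverse:
  "L ** Lp = mat 1 - averaging" "Lp ** L = mat 1 - averaging" "averaging ** Lp = 0"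
proof -
  define N where "N = matrix_inv (L + averaging)"
  note N = matrix_inv_props[OF invertible_laplacian_averaging, folded N_def]
  define X where "X = N - averaging"
  have aN: "averaging ** N = averaging"
  proof -
    have "averaging ** (L + averaging) = averaging"
      by (simp add: matrix_add_ldistrib averaging_laplacian averaging_idem)
    then show ?thesis by (metis N(1) matrix_mul_assoc matrix_mul_rid)
  qed
  have Na: "N ** averaging = averaging"
  proof -
    have "(L + averaging) ** averaging = averaging"
      by (simp add: matrix_add_rdistrib averaging_laplacian averaging_idem)
    then show ?thesis by (metis N(2) matrix_mul_assoc matrix_mul_lid)
  qed
  have LN: "L ** N = mat 1 - averaging" "N ** L = mat 1 - averaging"
    using N by (simp_all add: matrix_add_ldistrib matrix_add_rdistrib aN Na algebra_simps)
  have LX: "L ** X = mat 1 - averaging" and XL: "X ** L = mat 1 - averaging"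
    and aX: "averaging ** X = 0"
    by (simp_all add: X_def matrix_mult_diff_left matrix_mult_diff_right LN averaging_laplacian aN
        averaging_idem)
  have "is_pseudoinverse L X"
    unfolding is_pseudoinverse_def LX XL
    by (simp add: matrix_mult_diff_left averaging_laplacian aX transpose_diff transpose_averaging
        transpose_mat)
  then have "Lp = X" by (rule pseudoinverse_eqI)
  then show "L ** Lp = mat 1 - averaging" "Lp ** L = mat 1 - averaging" "averaging ** Lp = 0"
    using LX XL aX by auto
qed

lemma laplacian_Lp: 
  assumes "1 \<bullet> y = 0"
  shows "L *v (Lp *v y) = y"
  using assms by (simp add: matrix_vector_mul_assoc laplacian_pseudoinverse
      matrix_vector_mult_diff_rdistrib averaging_mult)

lemma edge_difference_Lp_laplacian: "transpose B *v (Lp *v (L *v z)) = transpose B *v z"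
proof -
  have "Lp *v (L *v z) = z - averaging *v z"
    by (simp add: matrix_vector_mul_assoc laplacian_pseudoinverse matrix_vector_mult_diff_rdistrib)
  then have "z = Lp *v (L *v z) + averaging *v z" by simp
  then have "transpose B *v z = transpose B *v (Lp *v (L *v z)) + transpose B *v (averaging *v z)"
    by (metis edge_difference_add)
  then show ?thesis by (simp only: averaging_mult edge_difference_one add_0_right)
qed

lemma one_orth_Lp: "1 \<bullet> (Lp *v y) = 0"
proof -
  have "averaging *v (Lp *v y) = 0"
    by (simp add: matrix_vector_mul_assoc laplacian_pseudoinverse)
  then show ?thesis by (simp add: averaging_mult vec_eq_iff)
qed

lemma one_orth_BW: "1 \<bullet> ((B ** W) *v y) = 0"
  using edge_difference_one[of 1] by (simp only: inner_BW scaleR_one) simp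

lemma cycle_projection_mult:
  "cycle_projection B W *v v = v - transpose B *v (Lp *v ((B ** W) *v v))"
  by (simp add: cycle_projection_def cutset_projection_def matrix_vector_mult_diff_rdistrib
      matrix_vector_mul_assoc matrix_mul_assoc del: transpose_matrix_vector)

lemma cycle_projection_edge_difference: "cycle_projection B W *v (transpose B *v z) = 0"
  by (simp only: cycle_projection_mult laplacian_mult[symmetric] edge_difference_Lp_laplacian
      diff_self)

lemma cycle_projection_idem:
  "cycle_projection B W *v (cycle_projection B W *v v) = cycle_projection B W *v v"
  by (subst (2) cycle_projection_mult)
    (simp only: matrix_vector_mult_diff_distrib cycle_projection_edge_difference diff_0_right)

lemma BW_cycle_projection: "(B ** W) *v (cycle_projection B W *v v) = 0"
  using laplacian_Lp[OF one_orth_BW[of v]]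
  by (simp only: cycle_projection_mult matrix_vector_mult_diff_distrib laplacian_mult diff_self)

text \<open>
  The flow equation and the requirement that the phase differences be a cutset vector are together
  one fixed-point equation for the edge variable \<open>\<psi> = sin (B\<^sup>T x)\<close>.
\<close>

lemma equilibrium_of_fixed_point:
  assumes \<omega>: "1 \<bullet> \<omega> = 0"
    and \<eta>: "\<eta> = transpose B *v (Lp *v \<omega>)"
    and fp: "\<psi> = \<eta> - cycle_projection B W *v (\<phi> - \<psi>)"
  obtains x where "1 \<bullet> x = 0" "transpose B *v x = \<phi>" "\<omega> = (B ** W) *v \<psi>"
proof
  let ?P = "cycle_projection B W"
  have "?P *v \<psi> = ?P *v \<eta> - ?P *v (?P *v (\<phi> - \<psi>))"
    using fp by (metis matrix_vector_mult_diff_distrib)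
  also have "\<dots> = ?P *v \<psi> - ?P *v \<phi>"
    by (simp only: \<eta> cycle_projection_edge_difference cycle_projection_idem)
      (simp add: matrix_vector_mult_diff_distrib)
  finally have "?P *v \<phi> = 0" by simp
  then show "transpose B *v (Lp *v ((B ** W) *v \<phi>)) = \<phi>"
    by (simp add: cycle_projection_mult del: transpose_matrix_vector)
  show "1 \<bullet> (Lp *v ((B ** W) *v \<phi>)) = 0" by (rule one_orth_Lp)
  have "(B ** W) *v \<psi> = (B ** W) *v \<eta> - (B ** W) *v (?P *v (\<phi> - \<psi>))"
    using fp by (metis matrix_vector_mult_diff_distrib)
  also have "\<dots> = L *v (Lp *v \<omega>)"
    by (simp only: BW_cycle_projection \<eta> laplacian_mult diff_0_right)
  finally show "\<omega> = (B ** W) *v \<psi>" using laplacian_Lp[OF \<omega>] by simp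
qed

lemma equilibrium_unique:
  assumes \<gamma>: "\<gamma> < pi / 2"
    and x: "x \<in> cohesive_vectors B \<gamma>" and y: "y \<in> cohesive_vectors B \<gamma>"
    and eq: "(B ** W) *v sin_vec (transpose B *v x) = (B ** W) *v sin_vec (transpose B *v y)"
  shows "x = y"
proof -
  define u v where "u = transpose B *v x" and "v = transpose B *v y"
  have uv: "transpose B *v (x - y) = u - v"
    by (simp add: u_def v_def matrix_vector_mult_diff_distrib del: transpose_matrix_vector)
  have bd: "\<bar>u $ e\<bar> \<le> \<gamma>" "\<bar>v $ e\<bar> \<le> \<gamma>" for e
    using x y unfolding cohesive_vectors_def u_def v_def infnorm_le_iff_cart by auto
  have "(B ** W) *v (sin_vec u - sin_vec v) = 0"
    using eq by (simp only: u_def v_def matrix_vector_mult_diff_distrib diff_self)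
  then have "(x - y) \<bullet> ((B ** W) *v (sin_vec u - sin_vec v)) = 0" by simp
  then have s0: "(\<Sum>e\<in>UNIV. weight e * ((u $ e - v $ e) * (sin (u $ e) - sin (v $ e)))) = 0"
    unfolding inner_BW uv by (simp add: sin_vec_def mult.assoc)
  have pos: "0 < cos \<gamma>"
    using \<gamma> order_trans[OF abs_ge_zero bd(1)] by (intro cos_gt_zero_pi) auto
  have ge: "cos \<gamma> * (u $ e - v $ e)\<^sup>2 \<le> (u $ e - v $ e) * (sin (u $ e) - sin (v $ e))" for e
    using bd \<gamma> by (intro sin_diff_coercive) auto
  have nn: "0 \<le> (u $ e - v $ e) * (sin (u $ e) - sin (v $ e))" for e
    using ge[of e] pos by (smt (verit) mult_nonneg_nonneg zero_le_power2)
  have "u $ e = v $ e" for e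
  proof -
    have "weight e * ((u $ e - v $ e) * (sin (u $ e) - sin (v $ e))) = 0"
      using s0 nn weight_pos by (subst (asm) sum_nonneg_eq_0_iff) (auto simp: less_imp_le)
    then have "(u $ e - v $ e) * (sin (u $ e) - sin (v $ e)) = 0" using weight_pos[of e] by simp
    with ge[of e] have "cos \<gamma> * (u $ e - v $ e)\<^sup>2 \<le> 0" by simp
    then show ?thesis using pos by (simp add: mult_le_0_iff)
  qed
  then have "transpose B *v (x - y) = 0" unfolding uv by (simp add: vec_eq_iff)
  moreover have "1 \<bullet> (x - y) = 0"
    using x y by (simp add: cohesive_vectors_def inner_diff_right)
  ultimately show ?thesis using edge_difference_eq_0_imp_0 by fastforce
qed

end

section \<open>The quotient of the torus by rotations\<close>

lemma cis_reduce:
  obtains t where "0 \<le> t" "t < 2 * pi" "cis t = cis s"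
proof
  show "0 \<le> Arg2pi (cis s)" "Arg2pi (cis s) < 2 * pi"
    by (rule Arg2pi_ge_0 Arg2pi_lt_2pi)+
  show "cis (Arg2pi (cis s)) = cis s"
    using Arg2pi_eq[of "cis s"] by (simp add: cis_conv_exp)
qed

lemma rotation_class_eq: "rotation_class z = {w. \<exists>s. w = (\<chi> i. cis s * z $ i)}"
  unfolding rotation_class_def by (metis cis_reduce)

lemma self_in_rotation_class: "z \<in> rotation_class z"
  unfolding rotation_class_eq by (auto intro: exI[of _ 0] simp: vec_eq_iff)

text \<open>
  Phase vectors give the same class iff they differ by a common shift, up to full turns in each
  component.
\<close>

lemma phase_class_eq_iff:
  "phase_class \<theta> = phase_class \<theta>' \<longleftrightarrow> (\<exists>c. \<forall>i. cis (\<theta> $ i) = cis (c + \<theta>' $ i))"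
proof
  assume "phase_class \<theta> = phase_class \<theta>'"
  then have "(\<chi> i. cis (\<theta> $ i)) \<in> phase_class \<theta>'"
    using self_in_rotation_class unfolding phase_class_def by blast
  then show "\<exists>c. \<forall>i. cis (\<theta> $ i) = cis (c + \<theta>' $ i)"
    unfolding phase_class_def rotation_class_eq by (auto simp: vec_eq_iff cis_mult)
next
  assume "\<exists>c. \<forall>i. cis (\<theta> $ i) = cis (c + \<theta>' $ i)"
  then obtain c where c: "\<And>i. cis (\<theta> $ i) = cis c * cis (\<theta>' $ i)" by (auto simp: cis_mult)
  have "\<exists>t. \<forall>i. cis s * cis (\<theta> $ i) = cis t * cis (\<theta>' $ i)" for s
    by (rule exI[of _ "s + c"]) (simp add: c cis_mult add.assoc)
  moreover have "\<exists>t. \<forall>i. cis s * cis (\<theta>' $ i) = cis t * cis (\<theta> $ i)" for s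
    by (rule exI[of _ "s - c"]) (simp add: c cis_mult)
  ultimately show "phase_class \<theta> = phase_class \<theta>'"
    unfolding phase_class_def rotation_class_eq by (auto simp: vec_eq_iff)
qed

lemma phase_in_torus: "(\<chi> i. cis (\<theta> $ i)) \<in> torus"
  by (simp add: torus_def)

lemma continuous_phase_class:
  "continuous_map euclidean quotient_torus_topology (phase_class :: real^'n::finite \<Rightarrow> _)"
proof -
  have "continuous_on UNIV (\<lambda>\<theta>::real^'n. \<chi> i. cis (\<theta> $ i))"
    by (intro continuous_intros)
  then have "continuous_map euclidean (top_of_set torus) (\<lambda>\<theta>::real^'n. \<chi> i. cis (\<theta> $ i))"
    by (auto simp: continuous_map_in_subtopology phase_in_torus)
  then have "continuous_map euclidean quotient_torus_topology
      (rotation_class \<circ> (\<lambda>\<theta>::real^'n. \<chi> i. cis (\<theta> $ i)))"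
    using quotient_imp_continuous_map[OF quotient_map_rotation_class] by (rule continuous_map_compose)
  then show ?thesis by (simp add: phase_class_def[abs_def] o_def)
qed

lemma phase_class_neighbourhood_ball:
  fixes x :: "real^'n::finite"
  assumes "openin quotient_torus_topology U" "phase_class x \<in> U"
  obtains r where "0 < r" "\<And>y. norm (y - x) < r \<Longrightarrow> phase_class y \<in> U"
proof -
  have "open {y. phase_class y \<in> U}"
    using openin_continuous_map_preimage[OF continuous_phase_class assms(1)] by simp
  then obtain r where "0 < r" "ball x r \<subseteq> {y. phase_class y \<in> U}"
    using assms(2) open_contains_ball by blast
  then show thesis
    by (intro that[of r]) (auto simp: subset_iff dist_norm norm_minus_commute)
qed

text \<open>
  Continuity of the argument at \<open>1\<close>.
\<close>

lemma cis_near_1: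
  assumes "0 < \<rho>"
  obtains r where "0 < r" "\<And>\<alpha>. cmod (cis \<alpha> - 1) < r \<Longrightarrow> \<exists>\<delta>. \<bar>\<delta>\<bar> < \<rho> \<and> cis \<delta> = cis \<alpha>"
proof -
  have "isCont Ln 1" by (intro continuous_at_Ln) auto
  then obtain r where r: "0 < r" "\<And>z. dist z 1 < r \<Longrightarrow> dist (Ln z) (Ln 1) < \<rho>"
    using assms unfolding continuous_at_eps_delta by blast
  show thesis
  proof
    fix \<alpha> assume "cmod (cis \<alpha> - 1) < r"
    then have "cmod (Ln (cis \<alpha>)) < \<rho>" using r(2)[of "cis \<alpha>"] by (simp add: dist_norm)
    then have "\<bar>Im (Ln (cis \<alpha>))\<bar> < \<rho>" using abs_Im_le_cmod order_le_less_trans by blast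
    moreover have "cis (Im (Ln (cis \<alpha>))) = cis \<alpha>"
    proof -
      have "Re (Ln (cis \<alpha>)) = 0" by simp
      then have "exp (Ln (cis \<alpha>)) = cis (Im (Ln (cis \<alpha>)))" by (simp add: exp_eq_polar)
      then show ?thesis by simp
    qed
    ultimately show "\<exists>\<delta>. \<bar>\<delta>\<bar> < \<rho> \<and> cis \<delta> = cis \<alpha>" by blast
  qed (rule r)
qed

text \<open>
  Classes near \<open>[exp(\<i> x)]\<close> have representatives near \<open>x\<close>. The neighbourhood is cut out by the
  rotation-invariant quantities \<open>z\<^sub>i * cnj z\<^sub>j\<close>, which makes its openness evident.
\<close>

lemma phase_class_lift_neighbourhood:
  fixes x :: "real^'n::finite"
  assumes R: "0 < R"
  obtains V where "openin quotient_torus_topology V" "phase_class x \<in> V"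
    "\<And>\<theta>. phase_class \<theta> \<in> V \<Longrightarrow>
      \<exists>y c. (\<forall>i. cis (\<theta> $ i) = cis (c + y $ i)) \<and> 1 \<bullet> (y - x) = 0 \<and> norm (y - x) < R"
proof -
  define \<rho> where "\<rho> = R / real CARD('n)"
  have "0 < \<rho>" using R by (simp add: \<rho>_def)
  then obtain r where r: "0 < r" "\<And>\<alpha>. cmod (cis \<alpha> - 1) < r \<Longrightarrow> \<exists>\<delta>. \<bar>\<delta>\<bar> < \<rho> \<and> cis \<delta> = cis \<alpha>"
    using cis_near_1 by blast
  define C where "C = {z :: complex^'n. \<forall>i j. cmod (z $ i * cnj (z $ j) - cis (x $ i - x $ j)) < r}"
  have C_eq: "C = (\<Inter>i. \<Inter>j. {z. cmod (z $ i * cnj (z $ j) - cis (x $ i - x $ j)) < r})"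
    by (auto simp: C_def)
  have "open C"
    unfolding C_eq by (intro open_INT open_Collect_less continuous_intros ballI) auto
  have inv: "z \<in> C" if "rotation_class z = rotation_class w" "w \<in> C" for z w
  proof -
    have "z \<in> rotation_class w" using self_in_rotation_class[of z] that(1) by simp
    then obtain s where z: "z = (\<chi> i. cis s * w $ i)"
      unfolding rotation_class_eq by auto
    have "z $ i * cnj (z $ j) = w $ i * cnj (w $ j)" for i j
    proof -
      have "z $ i * cnj (z $ j) = (cis s * cnj (cis s)) * (w $ i * cnj (w $ j))"
        unfolding z by simp
      also have "cis s * cnj (cis s) = 1" by (simp add: cis_cnj cis_mult)
      finally show ?thesis by simp
    qed
    then show ?thesis using that(2) by (simp add: C_def)
  qed
  define V where "V = rotation_class ` (torus \<inter> C)"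
  show thesis
  proof
    have "{z \<in> torus. rotation_class z \<in> V} = torus \<inter> C"
      unfolding V_def using inv by blast
    then show "openin quotient_torus_topology V"
      unfolding openin_quotient_torus_topology using \<open>open C\<close>
      by (auto simp: V_def quotient_torus_def openin_open)
    have "(\<chi> i. cis (x $ i)) \<in> C"
      using r(1) by (simp add: C_def cis_cnj cis_mult)
    then show "phase_class x \<in> V"
      unfolding V_def phase_class_def using phase_in_torus by blast
  next
    fix \<theta> :: "real^'n" assume "phase_class \<theta> \<in> V"
    then have "(\<chi> i. cis (\<theta> $ i)) \<in> C"
      unfolding V_def phase_class_def using inv by blast
    then have close: "cmod (cis (\<theta> $ i - \<theta> $ j) - cis (x $ i - x $ j)) < r" for i j
      by (simp add: C_def cis_cnj cis_mult)
    obtain j :: 'n where True by blast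
    define \<alpha> where "\<alpha> i = (\<theta> $ i - \<theta> $ j) - (x $ i - x $ j)" for i
    have "cmod (cis (\<alpha> i) - 1) < r" for i
    proof -
      have "cis (\<alpha> i) - 1 = (cis (\<theta> $ i - \<theta> $ j) - cis (x $ i - x $ j)) / cis (x $ i - x $ j)"
        by (simp add: \<alpha>_def diff_divide_distrib cis_divide)
      then show ?thesis using close[of i j] by (simp add: norm_divide)
    qed
    then have "\<exists>\<delta>. \<bar>\<delta>\<bar> < \<rho> \<and> cis \<delta> = cis (\<alpha> i)" for i using r(2) by blast
    then obtain \<delta> where \<delta>: "\<And>i. \<bar>\<delta> i\<bar> < \<rho>" "\<And>i. cis (\<delta> i) = cis (\<alpha> i)" by metis
    \<comment> \<open>subtracting the mean \<open>m\<close> makes the displacement orthogonal to the all-ones vector and does not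
        increase its norm\<close>
    define D where "D = (\<chi> i. \<delta> i)"
    define m where "m = (1 \<bullet> D) / real CARD('n)"
    define p where "p = D - m *\<^sub>R 1"
    have n1: "(1 :: real^'n) \<bullet> 1 = real CARD('n)" by (rule inner_one_one)
    have orth: "1 \<bullet> p = 0"
      by (simp add: p_def m_def inner_diff_right n1)
    have "p \<bullet> p \<le> D \<bullet> D"
    proof -
      have "D = p + m *\<^sub>R 1" by (simp add: p_def)
      then have "D \<bullet> D = p \<bullet> p + m * m * (1 \<bullet> (1 :: real^'n))"
        using orth by (simp add: inner_add_left inner_add_right inner_commute)
      then show ?thesis by (simp add: n1)
    qed
    then have "norm p \<le> norm D" by (simp add: norm_le)
    also have "norm D \<le> (\<Sum>i\<in>UNIV. \<bar>D $ i\<bar>)" by (rule norm_le_l1_cart)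
    also have "\<dots> < (\<Sum>i\<in>(UNIV :: 'n set). \<rho>)"
      using \<delta>(1) by (intro sum_strict_mono) (auto simp: D_def)
    also have "\<dots> = R" by (simp add: \<rho>_def)
    finally have "norm p < R" .
    moreover have "cis (\<theta> $ i) = cis ((\<theta> $ j - x $ j + m) + (x + p) $ i)" for i
    proof -
      have "\<theta> $ i = \<alpha> i + (\<theta> $ j - x $ j + x $ i)" by (simp add: \<alpha>_def)
      then have "cis (\<theta> $ i) = cis (\<alpha> i) * cis (\<theta> $ j - x $ j + x $ i)" by (metis cis_mult)
      also have "\<dots> = cis (\<delta> i + (\<theta> $ j - x $ j + x $ i))" by (simp only: \<delta>(2)[symmetric] cis_mult)
      also have "\<delta> i + (\<theta> $ j - x $ j + x $ i) = (\<theta> $ j - x $ j + m) + (x + p) $ i"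
        by (simp add: p_def D_def)
      finally show ?thesis .
    qed
    ultimately show "\<exists>y c. (\<forall>i. cis (\<theta> $ i) = cis (c + y $ i)) \<and> 1 \<bullet> (y - x) = 0 \<and> norm (y - x) < R"
      using orth by (intro exI[of _ "x + p"] exI[of _ "\<theta> $ j - x $ j + m"]) auto
  qed
qed

section \<open>Local stability\<close>

text \<open>
  A differential inequality that is only known while \<open>v < r\<close> keeps \<open>v\<close> below \<open>r\<close> and hence holds for
  all times.
\<close>

lemma exponential_decay:
  fixes v v' :: "real \<Rightarrow> real"
  assumes der: "\<And>t. 0 \<le> t \<Longrightarrow> (v has_real_derivative v' t) (at t within {0..})"
    and ineq: "\<And>t. 0 \<le> t \<Longrightarrow> v t < r \<Longrightarrow> v' t \<le> - \<sigma> * v t"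
    and nn: "0 \<le> v 0" and init: "v 0 < r" and \<sigma>: "0 < \<sigma>" and t: "0 \<le> t"
  shows "v t \<le> v 0 * exp (- \<sigma> * t)"
proof -
  have cont: "continuous_on {0..} v"
    using der by (auto simp: continuous_on_eq_continuous_within intro: DERIV_continuous)
  have decay: "v T \<le> v 0 * exp (- \<sigma> * T)" if T: "0 < T" and below: "\<And>s. 0 < s \<Longrightarrow> s < T \<Longrightarrow> v s < r" for T
  proof -
    have "v T * exp (\<sigma> * T) \<le> v 0 * exp (\<sigma> * 0)"
    proof (rule DERIV_nonpos_imp_decreasing_open[OF less_imp_le[OF T]])
      fix s assume s: "0 < s" "s < T"
      have "at s within {0..} = at s"
        using s by (intro at_within_interior) simp
      then have "(v has_real_derivative v' s) (at s)" using der[of s] s by simp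
      then have "((\<lambda>s. v s * exp (\<sigma> * s)) has_real_derivative (v' s + \<sigma> * v s) * exp (\<sigma> * s)) (at s)"
        by (auto intro!: derivative_eq_intros simp: algebra_simps)
      moreover have "(v' s + \<sigma> * v s) * exp (\<sigma> * s) \<le> 0"
        using ineq[of s] below[OF s] s by (simp add: mult_le_0_iff)
      ultimately show "\<exists>y. ((\<lambda>s. v s * exp (\<sigma> * s)) has_real_derivative y) (at s) \<and> y \<le> 0" by blast
    next
      show "continuous_on {0..T} (\<lambda>s. v s * exp (\<sigma> * s))"
        by (intro continuous_intros continuous_on_subset[OF cont]) auto
    qed
    then show ?thesis by (simp add: exp_minus field_simps)
  qed
  have below: "v s < r" if "0 \<le> s" for s
  proof (rule ccontr)
    assume "\<not> v s < r"
    \<comment> \<open>The minimum \<open>T\<close> of \<open>S\<close> is the first time at which \<open>v\<close> reaches \<open>r\<close>.\<close>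
    define S where "S = {0..s} \<inter> v -` {r..}"
    have "continuous_on {0..s} v" using cont by (rule continuous_on_subset) auto
    then have "closed S" unfolding S_def by (intro continuous_closed_preimage) auto
    then have "compact S"
      unfolding S_def by (metis bounded_Int bounded_closed_interval compact_eq_bounded_closed)
    moreover have "S \<noteq> {}" using \<open>\<not> v s < r\<close> that by (auto simp: S_def)
    ultimately have "\<exists>T\<in>S. \<forall>s\<in>S. T \<le> s" by (rule compact_attains_inf)
    then obtain T where T: "T \<in> S" "\<And>s. s \<in> S \<Longrightarrow> T \<le> s" by blast
    have "T \<noteq> 0" using T(1) init by (auto simp: S_def)
    then have "0 < T" using T(1) by (auto simp: S_def)
    have lt: "v q < r" if "0 < q" "q < T" for q
    proof (rule ccontr)
      assume "\<not> v q < r"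
      then have "q \<in> S" using that T(1) by (auto simp: S_def)
      then show False using T(2)[of q] that by simp
    qed
    have "v T \<le> v 0 * exp (- \<sigma> * T)" using \<open>0 < T\<close> lt by (rule decay)
    also have "\<dots> \<le> v 0 * 1" using nn \<sigma> \<open>0 < T\<close> by (intro mult_left_mono) auto
    finally show False using T(1) init by (auto simp: S_def)
  qed
  show ?thesis
  proof (cases "t = 0")
    case False
    then show ?thesis using t below by (intro decay) auto
  qed simp
qed

context kuramoto_network
begin

lemma sin_edge_difference_invariant:
  assumes "\<And>i. cis (\<theta> $ i) = cis (c + \<theta>' $ i)"
  shows "sin_vec (transpose B *v \<theta>) = sin_vec (transpose B *v \<theta>')"
proof -
  have "cis (\<theta> $ i - \<theta> $ j) = cis (\<theta>' $ i - \<theta>' $ j)" for i j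
  proof -
    have "cis (\<theta> $ i - \<theta> $ j) = cis (\<theta> $ i) / cis (\<theta> $ j)" by (simp add: cis_divide)
    also have "\<dots> = cis (\<theta>' $ i - \<theta>' $ j)" unfolding assms by (simp add: cis_divide)
    finally show ?thesis .
  qed
  then have "sin (\<theta> $ i - \<theta> $ j) = sin (\<theta>' $ i - \<theta>' $ j)" for i j by (metis cis.sel(2))
  then show ?thesis
    by (simp add: sin_vec_def vec_eq_iff edge_difference del: transpose_matrix_vector)
qed

lemma synchronization_manifold_phase_class:
  "synchronization_manifold B W \<omega> (phase_class x) \<longleftrightarrow> \<omega> = (B ** W) *v sin_vec (transpose B *v x)"
proof
  assume "synchronization_manifold B W \<omega> (phase_class x)"
  then obtain \<theta> c where "\<And>i. cis (x $ i) = cis (c + \<theta> $ i)"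
      and \<omega>: "\<omega> = (B ** W) *v sin_vec (transpose B *v \<theta>)"
    unfolding synchronization_manifold_def phase_class_eq_iff by blast
  then have "sin_vec (transpose B *v x) = sin_vec (transpose B *v \<theta>)"
    by (intro sin_edge_difference_invariant)
  then show "\<omega> = (B ** W) *v sin_vec (transpose B *v x)" using \<omega> by (simp only:)
qed (auto simp only: synchronization_manifold_def)

lemma edge_difference_lower_bound:
  obtains \<kappa> where "0 < \<kappa>" "\<And>z. 1 \<bullet> z = 0 \<Longrightarrow> \<kappa> * norm z \<le> norm (transpose B *v z)"
proof -
  have "closed {z :: real^'n. 1 \<bullet> z = 0}" "subspace {z :: real^'n. 1 \<bullet> z = 0}"
    by (rule closed_hyperplane subspace_hyperplane)+
  then have "\<exists>\<kappa>>0. \<forall>z\<in>{z :: real^'n. 1 \<bullet> z = 0}. \<kappa> * norm z \<le> norm (transpose B *v z)"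
    by (intro injective_imp_isometric matrix_vector_mul_bounded_linear)
      (auto dest: edge_difference_eq_0_imp_0 simp del: transpose_matrix_vector)
  then show thesis using that by auto
qed

lemma weight_lower_bound:
  obtains w where "0 < w" "\<And>e. w \<le> weight e"
proof
  show "0 < Min (range weight)" using weight_pos by (subst Min_gr_iff) auto
  show "Min (range weight) \<le> weight e" for e by (rule Min_le) auto
qed

text \<open>
  Near a cohesive equilibrium the squared distance within the hyperplane orthogonal to the
  all-ones vector is a strict Lyapunov function.
\<close>

lemma trajectory_decay:
  assumes \<gamma>: "\<gamma> < pi / 2" and x: "infnorm (transpose B *v x) \<le> \<gamma>"
    and eq: "\<omega> = (B ** W) *v sin_vec (transpose B *v x)"
  obtains R \<sigma> where "0 < R" "0 < \<sigma>"
    "\<And>\<theta> t. kuramoto_solution B W \<omega> \<theta> \<Longrightarrow> 1 \<bullet> (\<theta> 0 - x) = 0 \<Longrightarrow> norm (\<theta> 0 - x) < R \<Longrightarrow> 0 \<le> t \<Longrightarrow>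
      (norm (\<theta> t - x))\<^sup>2 \<le> (norm (\<theta> 0 - x))\<^sup>2 * exp (- \<sigma> * t)"
proof -
  define \<beta> where "\<beta> = (\<gamma> + pi / 2) / 2"
  \<comment> \<open>A displacement of norm below \<open>R\<close> changes phase differences by less than \<open>2 R\<close>, which keeps
      them within \<open>\<beta>\<close>.\<close>
  define R where "R = (\<beta> - \<gamma>) / 2"
  have \<gamma>0: "0 \<le> \<gamma>" using x infnorm_pos_le[of "transpose B *v x"] by linarith
  have \<beta>: "\<beta> < pi / 2" "0 < \<beta>" "0 < R" using \<gamma> \<gamma>0 by (auto simp: \<beta>_def R_def)
  then have cos_pos: "0 < cos \<beta>" by (intro cos_gt_zero_pi) auto
  obtain \<kappa> where \<kappa>: "0 < \<kappa>" "\<And>z. 1 \<bullet> z = 0 \<Longrightarrow> \<kappa> * norm z \<le> norm (transpose B *v z)"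
    using edge_difference_lower_bound by blast
  obtain w where w: "0 < w" "\<And>e. w \<le> weight e" using weight_lower_bound by blast
  define \<sigma> where "\<sigma> = 2 * (w * cos \<beta> * \<kappa>\<^sup>2)"
  have \<sigma>: "0 < \<sigma>" using w \<kappa> cos_pos by (simp add: \<sigma>_def)
  have coercive: "2 * (q \<bullet> (\<omega> - (B ** W) *v sin_vec (transpose B *v (x + q)))) \<le> - \<sigma> * (q \<bullet> q)"
    if q: "1 \<bullet> q = 0" "norm q < R" for q
  proof -
    define p u where "p = transpose B *v q" and "u = transpose B *v x"
    have bd: "\<bar>u $ e\<bar> \<le> \<beta>" "\<bar>(u + p) $ e\<bar> \<le> \<beta>" for e
    proof -
      have "\<bar>u $ e\<bar> \<le> \<gamma>" using x infnorm_le_iff_cart unfolding u_def by blast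
      moreover have "\<bar>p $ e\<bar> \<le> norm q + norm q"
        unfolding p_def edge_difference using component_le_norm_cart[of q "fst (d e)"]
          component_le_norm_cart[of q "snd (d e)"] by linarith
      ultimately show "\<bar>u $ e\<bar> \<le> \<beta>" "\<bar>(u + p) $ e\<bar> \<le> \<beta>"
        using q(2) \<beta>(3) by (auto simp: R_def)
    qed
    have "(w * cos \<beta>) * (p $ e)\<^sup>2 \<le> weight e * (p $ e * (sin ((u + p) $ e) - sin (u $ e)))" for e
    proof -
      have c: "cos \<beta> * (p $ e)\<^sup>2 \<le> p $ e * (sin ((u + p) $ e) - sin (u $ e))"
        using sin_diff_coercive[OF bd(2) bd(1), of e e] \<beta> by simp
      have "w * (cos \<beta> * (p $ e)\<^sup>2) \<le> weight e * (cos \<beta> * (p $ e)\<^sup>2)"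
        using w(2) cos_pos by (intro mult_right_mono) auto
      also have "\<dots> \<le> weight e * (p $ e * (sin ((u + p) $ e) - sin (u $ e)))"
        using c weight_pos[of e] by (intro mult_left_mono) auto
      finally show ?thesis by (simp add: mult.assoc)
    qed
    then have sum: "(w * cos \<beta>) * (\<Sum>e\<in>UNIV. (p $ e)\<^sup>2)
        \<le> (\<Sum>e\<in>UNIV. weight e * (p $ e * (sin ((u + p) $ e) - sin (u $ e))))"
      unfolding sum_distrib_left by (rule sum_mono)
    have "\<omega> - (B ** W) *v sin_vec (transpose B *v (x + q)) = - ((B ** W) *v (sin_vec (u + p) - sin_vec u))"
      unfolding eq edge_difference_add u_def p_def by (simp only: matrix_vector_mult_diff_distrib minus_diff_eq)
    then have "q \<bullet> (\<omega> - (B ** W) *v sin_vec (transpose B *v (x + q)))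
        = - (\<Sum>e\<in>UNIV. weight e * (p $ e * (sin ((u + p) $ e) - sin (u $ e))))"
      by (simp add: inner_BW p_def[symmetric] sin_vec_def mult.assoc del: transpose_matrix_vector)
    moreover have "(\<kappa> * norm q)\<^sup>2 \<le> (norm p)\<^sup>2"
      unfolding p_def using \<kappa> q(1) by (intro power_mono) auto
    then have "\<kappa>\<^sup>2 * (q \<bullet> q) \<le> p \<bullet> p"
      by (simp add: power_mult_distrib power2_norm_eq_inner)
    then have "\<kappa>\<^sup>2 * (q \<bullet> q) \<le> (\<Sum>e\<in>UNIV. (p $ e)\<^sup>2)"
      by (simp add: inner_vec_def[of p] power2_eq_square[of "p $ _"])
    then have "(w * cos \<beta>) * (\<kappa>\<^sup>2 * (q \<bullet> q)) \<le> (w * cos \<beta>) * (\<Sum>e\<in>UNIV. (p $ e)\<^sup>2)"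
      using w cos_pos by (intro mult_left_mono) auto
    ultimately show ?thesis using sum by (simp add: \<sigma>_def mult.assoc)
  qed
  show thesis
  proof
    fix \<theta> :: "real \<Rightarrow> real^'n" and t :: real
    assume sol: "kuramoto_solution B W \<omega> \<theta>" and orth: "1 \<bullet> (\<theta> 0 - x) = 0"
      and init: "norm (\<theta> 0 - x) < R" and t: "0 \<le> t"
    define F where "F t = \<omega> - (B ** W) *v sin_vec (transpose B *v \<theta> t)" for t
    have der: "(\<theta> has_vector_derivative F t) (at t within {0..})" if "0 \<le> t" for t
      using sol that by (simp add: kuramoto_solution_def F_def del: transpose_matrix_vector)
    have F_orth: "1 \<bullet> F t = 0" for t
      by (simp only: F_def inner_diff_right one_orth_BW eq diff_self)
    have orth_t: "1 \<bullet> (\<theta> t - x) = 0" if "0 \<le> t" for t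
    proof -
      have "((\<lambda>t. 1 \<bullet> \<theta> t) has_vector_derivative 0) (at s within {0..})" if "s \<in> {0..}" for s
        using bounded_linear.has_vector_derivative[OF bounded_linear_inner_right der, of s 1] that
        by (simp add: F_orth)
      then obtain c where "\<And>s. s \<in> {0..} \<Longrightarrow> 1 \<bullet> \<theta> s = c"
        using has_vector_derivative_zero_constant[of "{0..}" "\<lambda>t. 1 \<bullet> \<theta> t"] by auto
      then have "1 \<bullet> \<theta> t = 1 \<bullet> \<theta> 0" using that by simp
      then show ?thesis using orth by (simp add: inner_diff_right)
    qed
    define v where "v t = (\<theta> t - x) \<bullet> (\<theta> t - x)" for t
    have v_norm: "v t = (norm (\<theta> t - x))\<^sup>2" for t by (simp add: v_def power2_norm_eq_inner)
    have "v t \<le> v 0 * exp (- \<sigma> * t)"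
    proof (rule exponential_decay[where r = "R\<^sup>2" and v' = "\<lambda>t. 2 * ((\<theta> t - x) \<bullet> F t)"])
      fix t :: real assume t: "0 \<le> t"
      have "((\<lambda>t. \<theta> t - x) has_derivative (\<lambda>h. h *\<^sub>R F t)) (at t within {0..})"
        using der[OF t] unfolding has_vector_derivative_def by (auto intro!: derivative_eq_intros)
      then have "(v has_derivative (\<lambda>h. (\<theta> t - x) \<bullet> (h *\<^sub>R F t) + (h *\<^sub>R F t) \<bullet> (\<theta> t - x)))
          (at t within {0..})"
        unfolding v_def[abs_def] by (intro has_derivative_inner)
      then show "(v has_real_derivative 2 * ((\<theta> t - x) \<bullet> F t)) (at t within {0..})"
        unfolding has_field_derivative_def
        by (rule has_derivative_eq_rhs) (simp add: fun_eq_iff inner_commute)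
      assume "v t < R\<^sup>2"
      then have "norm (\<theta> t - x) < R"
        unfolding v_norm using \<beta>(3) by (intro power2_less_imp_less[of _ R]) auto
      then show "2 * ((\<theta> t - x) \<bullet> F t) \<le> - \<sigma> * v t"
        using coercive[OF orth_t[OF t]] by (simp add: F_def v_def del: transpose_matrix_vector)
    next
      show "v 0 < R\<^sup>2" unfolding v_norm using init by (intro power_strict_mono) auto
    qed (use \<sigma> t in \<open>auto simp: v_def\<close>)
    then show "(norm (\<theta> t - x))\<^sup>2 \<le> (norm (\<theta> 0 - x))\<^sup>2 * exp (- \<sigma> * t)"
      by (simp only: v_norm)
  qed (rule \<beta> \<sigma>)+
qed

lemma locally_stable_cohesive:
  assumes \<gamma>: "\<gamma> < pi / 2" and x: "infnorm (transpose B *v x) \<le> \<gamma>"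
    and eq: "\<omega> = (B ** W) *v sin_vec (transpose B *v x)"
  shows "locally_stable B W \<omega> (phase_class x)"
proof -
  obtain R \<sigma> where R: "0 < R" and \<sigma>: "0 < \<sigma>"
    and decay: "\<And>\<theta> t. kuramoto_solution B W \<omega> \<theta> \<Longrightarrow> 1 \<bullet> (\<theta> 0 - x) = 0 \<Longrightarrow> norm (\<theta> 0 - x) < R \<Longrightarrow>
      0 \<le> t \<Longrightarrow> (norm (\<theta> t - x))\<^sup>2 \<le> (norm (\<theta> 0 - x))\<^sup>2 * exp (- \<sigma> * t)"
    using trajectory_decay[OF \<gamma> x eq] by blast
  \<comment> \<open>A solution starting in a small neighbourhood is, up to rotation and full turns, one that
      starts near \<open>x\<close>.\<close>
  have shadow: "\<exists>V. openin quotient_torus_topology V \<and> phase_class x \<in> V \<and>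
      (\<forall>\<theta>. kuramoto_solution B W \<omega> \<theta> \<and> phase_class (\<theta> 0) \<in> V \<longrightarrow>
        (\<exists>\<theta>'. (\<forall>t. phase_class (\<theta> t) = phase_class (\<theta>' t)) \<and>
          (\<forall>t\<ge>0. (norm (\<theta>' t - x))\<^sup>2 \<le> r\<^sup>2 * exp (- \<sigma> * t))))"
    if r: "0 < r" "r \<le> R" for r
  proof -
    obtain V where V: "openin quotient_torus_topology V" "phase_class x \<in> V"
      "\<And>\<theta>. phase_class \<theta> \<in> V \<Longrightarrow>
        \<exists>y c. (\<forall>i. cis (\<theta> $ i) = cis (c + y $ i)) \<and> 1 \<bullet> (y - x) = 0 \<and> norm (y - x) < r"
      using phase_class_lift_neighbourhood[OF r(1), of x] by blast
    have "\<exists>\<theta>'. (\<forall>t. phase_class (\<theta> t) = phase_class (\<theta>' t)) \<and>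
          (\<forall>t\<ge>0. (norm (\<theta>' t - x))\<^sup>2 \<le> r\<^sup>2 * exp (- \<sigma> * t))"
      if sol: "kuramoto_solution B W \<omega> \<theta>" and start: "phase_class (\<theta> 0) \<in> V" for \<theta>
    proof -
      obtain y c where y: "\<And>i. cis (\<theta> 0 $ i) = cis (c + y $ i)" "1 \<bullet> (y - x) = 0" "norm (y - x) < r"
        using V(3)[OF start] by blast
      define \<theta>' where "\<theta>' t = \<theta> t - (\<theta> 0 - y)" for t
      have shift: "cis (\<theta> t $ i) = cis (c + \<theta>' t $ i)" for t i
      proof -
        have "cis (\<theta> t $ i) = cis (\<theta>' t $ i - y $ i) * cis (\<theta> 0 $ i)"
          by (simp add: \<theta>'_def cis_mult)
        also have "\<dots> = cis (c + \<theta>' t $ i)" unfolding y(1) by (simp add: cis_mult algebra_simps)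
        finally show ?thesis .
      qed
      have "(\<theta>' has_vector_derivative (\<omega> - (B ** W) *v sin_vec (transpose B *v \<theta>' t))) (at t within {0..})"
        if "0 \<le> t" for t
      proof -
        have "(\<theta> has_vector_derivative (\<omega> - (B ** W) *v sin_vec (transpose B *v \<theta> t))) (at t within {0..})"
          using sol that by (simp add: kuramoto_solution_def del: transpose_matrix_vector)
        also have "sin_vec (transpose B *v \<theta> t) = sin_vec (transpose B *v \<theta>' t)"
          using shift by (rule sin_edge_difference_invariant)
        finally show ?thesis
          unfolding \<theta>'_def[abs_def] has_vector_derivative_def by (auto intro!: derivative_eq_intros)
      qed
      then have "kuramoto_solution B W \<omega> \<theta>'" unfolding kuramoto_solution_def by blast
      moreover have "\<theta>' 0 = y" by (simp add: \<theta>'_def)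
      ultimately have dec: "(norm (\<theta>' t - x))\<^sup>2 \<le> (norm (y - x))\<^sup>2 * exp (- \<sigma> * t)" if "0 \<le> t" for t
        using decay[of \<theta>' t] y r that by simp
      have "(norm (y - x))\<^sup>2 * exp (- \<sigma> * t) \<le> r\<^sup>2 * exp (- \<sigma> * t)" for t
        using y(3) by (intro mult_right_mono power_mono) auto
      then have "(norm (\<theta>' t - x))\<^sup>2 \<le> r\<^sup>2 * exp (- \<sigma> * t)" if "0 \<le> t" for t
        using dec[OF that] order_trans by blast
      moreover have "phase_class (\<theta> t) = phase_class (\<theta>' t)" for t
        unfolding phase_class_eq_iff using shift by blast
      ultimately show ?thesis by blast
    qed
    then show ?thesis using V(1,2) by blast
  qed
  have lyapunov: "\<exists>V. openin quotient_torus_topology V \<and> phase_class x \<in> V \<and>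
      (\<forall>\<theta>. kuramoto_solution B W \<omega> \<theta> \<and> phase_class (\<theta> 0) \<in> V \<longrightarrow> (\<forall>t\<ge>0. phase_class (\<theta> t) \<in> U))"
    if U: "openin quotient_torus_topology U" "phase_class x \<in> U" for U
  proof -
    obtain \<rho> where \<rho>: "0 < \<rho>" "\<And>y. norm (y - x) < \<rho> \<Longrightarrow> phase_class y \<in> U"
      using phase_class_neighbourhood_ball[OF U] by blast
    define r where "r = min R (\<rho> / 2)"
    have r: "0 < r" "r \<le> R" "r < \<rho>" using R \<rho>(1) by (auto simp: r_def)
    obtain V where V: "openin quotient_torus_topology V" "phase_class x \<in> V"
      "\<And>\<theta>. kuramoto_solution B W \<omega> \<theta> \<and> phase_class (\<theta> 0) \<in> V \<Longrightarrow>
        \<exists>\<theta>'. (\<forall>t. phase_class (\<theta> t) = phase_class (\<theta>' t)) \<and>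
          (\<forall>t\<ge>0. (norm (\<theta>' t - x))\<^sup>2 \<le> r\<^sup>2 * exp (- \<sigma> * t))"
      using shadow[OF r(1,2)] by blast
    have "phase_class (\<theta> t) \<in> U"
      if \<theta>: "kuramoto_solution B W \<omega> \<theta> \<and> phase_class (\<theta> 0) \<in> V" and t: "0 \<le> t" for \<theta> t
    proof -
      obtain \<theta>' where \<theta>': "phase_class (\<theta> t) = phase_class (\<theta>' t)"
          "(norm (\<theta>' t - x))\<^sup>2 \<le> r\<^sup>2 * exp (- \<sigma> * t)"
        using V(3)[OF \<theta>] t by blast
      have "r\<^sup>2 * exp (- \<sigma> * t) \<le> r\<^sup>2 * 1" using \<sigma> t by (intro mult_left_mono) auto
      with \<theta>'(2) have "(norm (\<theta>' t - x))\<^sup>2 \<le> r\<^sup>2" by simp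
      then have "norm (\<theta>' t - x) \<le> r" by (rule power2_le_imp_le) (use r(1) in simp)
      then show ?thesis using \<theta>'(1) \<rho>(2) r(3) by simp
    qed
    then show ?thesis using V(1,2) by blast
  qed
  obtain V where V: "openin quotient_torus_topology V" "phase_class x \<in> V"
    "\<And>\<theta>. kuramoto_solution B W \<omega> \<theta> \<and> phase_class (\<theta> 0) \<in> V \<Longrightarrow>
      \<exists>\<theta>'. (\<forall>t. phase_class (\<theta> t) = phase_class (\<theta>' t)) \<and>
        (\<forall>t\<ge>0. (norm (\<theta>' t - x))\<^sup>2 \<le> R\<^sup>2 * exp (- \<sigma> * t))"
    using shadow[OF R] by blast
  have "limitin quotient_torus_topology (\<lambda>t. phase_class (\<theta> t)) (phase_class x) at_top"
    if \<theta>: "kuramoto_solution B W \<omega> \<theta> \<and> phase_class (\<theta> 0) \<in> V" for \<theta>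
    unfolding limitin_def
  proof (intro conjI allI impI)
    show "phase_class x \<in> topspace quotient_torus_topology"
      using V(1,2) openin_subset by blast
  next
    fix U assume U: "openin quotient_torus_topology U \<and> phase_class x \<in> U"
    obtain \<rho> where \<rho>: "0 < \<rho>" "\<And>y. norm (y - x) < \<rho> \<Longrightarrow> phase_class y \<in> U"
      using phase_class_neighbourhood_ball U by blast
    obtain \<theta>' where \<theta>': "\<And>t. phase_class (\<theta> t) = phase_class (\<theta>' t)"
        "\<And>t. 0 \<le> t \<Longrightarrow> (norm (\<theta>' t - x))\<^sup>2 \<le> R\<^sup>2 * exp (- \<sigma> * t)"
      using V(3)[OF \<theta>] by blast
    have "filterlim (\<lambda>t. - \<sigma> * t) at_bot at_top"
      using \<sigma> by (intro filterlim_tendsto_neg_mult_at_bot[OF tendsto_const] filterlim_ident) auto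
    then have "((\<lambda>t. R\<^sup>2 * exp (- \<sigma> * t)) \<longlongrightarrow> 0) at_top"
      by (intro tendsto_mult_right_zero filterlim_compose[OF exp_at_bot])
    then have "\<forall>\<^sub>F t in at_top. R\<^sup>2 * exp (- \<sigma> * t) < \<rho>\<^sup>2"
      using \<rho>(1) by (intro order_tendstoD(2)) auto
    then show "\<forall>\<^sub>F t in at_top. phase_class (\<theta> t) \<in> U"
      using eventually_ge_at_top[of 0]
    proof eventually_elim
      case (elim t)
      then have "(norm (\<theta>' t - x))\<^sup>2 < \<rho>\<^sup>2" using \<theta>'(2)[of t] by simp
      then have "norm (\<theta>' t - x) < \<rho>" using \<rho>(1) by (intro power2_less_imp_less[of _ \<rho>]) auto
      then show ?case using \<theta>'(1) \<rho>(2) by simp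
    qed
  qed
  then show ?thesis
    unfolding locally_stable_def using lyapunov V(1,2) by blast
qed

end

section \<open>Existence, uniqueness, stability and the power series\<close>

theorem theorem6p1:
  fixes E :: "('n::finite \<times> 'n) set" and a :: "real^'n^'n"
    and d :: "'m::finite \<Rightarrow> 'n \<times> 'n"
    and B :: "real^'m^'n" and W :: "real^'m^'m" and Pcyc :: "real^'m^'m"
    and \<omega> :: "real^'n" and \<eta> :: "real^'m" and \<gamma> :: real
  assumes graph: "weighted_graph E a" "graph_connected E" "edge_orientation E d"
    and B: "B = incidence_matrix d"
    and W: "W = weight_matrix d a"
    and Pcyc: "Pcyc = cycle_projection B W"
    and \<omega>: "1 \<bullet> \<omega> = 0"
    and \<eta>: "\<eta> = transpose B *v (pseudoinverse (laplacian B W) *v \<omega>)"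
    and less: "infnorm \<eta> < h_fun (matrix_infnorm Pcyc)"
    and \<gamma>: "\<gamma> = gamma_star (infnorm \<eta>)"
  shows "(\<exists>!M. M \<in> embedded_cohesive_subset B \<gamma> \<and>
            synchronization_manifold B W \<omega> M \<and> locally_stable B W \<omega> M) \<and>
         (\<exists>c. (\<forall>i. homogeneous_polynomial (2 * i + 1) c (A_term Pcyc (2 * i + 1))) \<and>
            (\<forall>\<nu>. even (multi_degree \<nu>) \<longrightarrow> c \<nu> = 0) \<and>
            (\<forall>x\<in>cohesive_vectors B \<gamma>.
               synchronization_manifold B W \<omega> (phase_class x) \<and>
               locally_stable B W \<omega> (phase_class x) \<longrightarrow>
                 (\<lambda>i. A_term Pcyc (2 * i + 1) \<eta>) sums sin_vec (transpose B *v x) \<and>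
                 strongly_converges_to c 0 \<eta> (sin_vec (transpose B *v x))))"
proof -
  interpret kuramoto_network E a d B W
    by unfold_locales (fact graph B W)+
  define K where "K = matrix_infnorm Pcyc"
  define s where "s = sin \<gamma>"
  have row: "(\<Sum>f\<in>UNIV. \<bar>Pcyc $ e $ f\<bar>) \<le> K" for e
    unfolding K_def by (rule row_sum_le_matrix_infnorm)
  have K0: "0 \<le> K"
    using row[of undefined] by (rule order_trans[OF sum_nonneg, rotated]) simp
  have \<gamma>_bounds: "0 \<le> \<gamma>" "\<gamma> < pi / 2"
    and super: "infnorm \<eta> + K * (\<gamma> - sin \<gamma>) \<le> sin \<gamma>"
    using gamma_star_supersolution[OF K0 infnorm_pos_le less[folded K_def]] unfolding \<gamma> by auto
  have arcsin_s: "arcsin s = \<gamma>" unfolding s_def using \<gamma>_bounds by (intro arcsin_sin) auto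
  have s: "0 \<le> s" "s < 1"
    using \<gamma>_bounds sin_ge_zero[of \<gamma>] sin_monotone_2pi[of \<gamma> "pi / 2"] by (auto simp: s_def)
  have "infnorm \<eta> + K * (arcsin s - s) \<le> s" using super unfolding arcsin_s by (simp only: s_def)
  then obtain c \<psi> where c: "\<And>N. homogeneous_polynomial N c (A_term Pcyc N)"
      "\<And>\<nu>. even (multi_degree \<nu>) \<Longrightarrow> c \<nu> = 0"
    and \<psi>: "\<And>e. \<bar>\<psi> $ e\<bar> \<le> s" "\<psi> = \<eta> - Pcyc *v ((\<chi> e. arcsin (\<psi> $ e)) - \<psi>)"
    and conv: "(\<lambda>i. A_term Pcyc (2 * i + 1) \<eta>) sums \<psi>" "strongly_converges_to c 0 \<eta> \<psi>"
    using A_term_series[OF row infnorm_pos_le component_le_infnorm_cart s] by blast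
  obtain x where x: "1 \<bullet> x = 0" "transpose B *v x = (\<chi> e. arcsin (\<psi> $ e))"
      "\<omega> = (B ** W) *v \<psi>"
    using equilibrium_of_fixed_point[OF \<omega> \<eta> \<psi>(2)[unfolded Pcyc]] by blast
  have "sin (arcsin (\<psi> $ e)) = \<psi> $ e" for e
    using \<psi>(1)[of e] s by (intro sin_arcsin) auto
  then have sin_x: "sin_vec (transpose B *v x) = \<psi>"
    by (simp add: x(2) sin_vec_def del: transpose_matrix_vector)
  have "\<bar>arcsin (\<psi> $ e)\<bar> \<le> \<gamma>" for e
  proof -
    have "arcsin (\<psi> $ e) \<le> arcsin s" "arcsin (- s) \<le> arcsin (\<psi> $ e)"
      using \<psi>(1)[of e] s by (auto intro!: arcsin_le_arcsin)
    then show ?thesis using s by (simp add: arcsin_s arcsin_minus)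
  qed
  then have x_inf: "infnorm (transpose B *v x) \<le> \<gamma>"
    unfolding x(2) infnorm_le_iff_cart by simp
  then have x_coh: "x \<in> cohesive_vectors B \<gamma>"
    using x(1) by (simp only: cohesive_vectors_def mem_Collect_eq)
  have x_eq: "\<omega> = (B ** W) *v sin_vec (transpose B *v x)" using x(3) by (simp only: sin_x)
  have unique: "y = x" if "y \<in> cohesive_vectors B \<gamma>" "synchronization_manifold B W \<omega> (phase_class y)" for y
    using that(2) x_eq equilibrium_unique[OF \<gamma>_bounds(2) that(1) x_coh]
    unfolding synchronization_manifold_phase_class by simp
  have "\<exists>!M. M \<in> embedded_cohesive_subset B \<gamma> \<and>
            synchronization_manifold B W \<omega> M \<and> locally_stable B W \<omega> M"
  proof (rule ex1I[of _ "phase_class x"], intro conjI)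
    show "phase_class x \<in> embedded_cohesive_subset B \<gamma>"
      unfolding embedded_cohesive_subset_def using x_coh by (rule imageI)
    show "synchronization_manifold B W \<omega> (phase_class x)"
      unfolding synchronization_manifold_phase_class by (rule x_eq)
    show "locally_stable B W \<omega> (phase_class x)"
      using \<gamma>_bounds(2) x_inf x_eq by (rule locally_stable_cohesive)
  next
    fix M
    assume "M \<in> embedded_cohesive_subset B \<gamma> \<and> synchronization_manifold B W \<omega> M \<and> locally_stable B W \<omega> M"
    then show "M = phase_class x" unfolding embedded_cohesive_subset_def using unique by blast
  qed
  moreover have "\<forall>y\<in>cohesive_vectors B \<gamma>.
      synchronization_manifold B W \<omega> (phase_class y) \<and> locally_stable B W \<omega> (phase_class y) \<longrightarrow>
        (\<lambda>i. A_term Pcyc (2 * i + 1) \<eta>) sums sin_vec (transpose B *v y) \<and>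
        strongly_converges_to c 0 \<eta> (sin_vec (transpose B *v y))"
  proof (intro ballI impI)
    fix y assume "y \<in> cohesive_vectors B \<gamma>"
      "synchronization_manifold B W \<omega> (phase_class y) \<and> locally_stable B W \<omega> (phase_class y)"
    then have "y = x" using unique by blast
    then have "sin_vec (transpose B *v y) = \<psi>" using sin_x by (simp only:)
    then show "(\<lambda>i. A_term Pcyc (2 * i + 1) \<eta>) sums sin_vec (transpose B *v y) \<and>
        strongly_converges_to c 0 \<eta> (sin_vec (transpose B *v y))"
      using conv by (simp only: simp_thms)
  qed
  ultimately show ?thesis
    using c by (intro conjI exI[of _ c] allI impI) assumption+
qed

end
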